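(* Let $G$ be a finite group, $\chi\in\operatorname{Irr}(G)$, and $\mathbb{E}:=\mathbb{Q}(\chi)$. Then for every subfield $\mathbb{F}$ of $\mathbb{E}$ (containing $\mathbb{Q}$) there exist a finite group $H$ and $\psi\in\operatorname{Irr}(H)$ such that $\mathbb{Q}(\psi)=\mathbb{F}$ and $\psi(1)=n\,\chi(1)^n$, where $n:=[\mathbb{E}:\mathbb{F}]$.
   Context: $\operatorname{Irr}(G)$ is the set of complex irreducible characters of $G$; $\mathbb{Q}(\chi)$ is the field generated over $\mathbb{Q}$ by the values of $\chi$ (an abelian extension of $\mathbb{Q}$). *)

theory Defs
  imports "HOL-Algebra.Group" "Jordan_Normal_Form.Matrix"
begin

definition is_rep :: "('g, 'b) monoid_scheme \<Rightarrow> nat \<Rightarrow> ('g \<Rightarrow> complex mat) \<Rightarrow> bool" where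
  "is_rep G d \<rho> \<longleftrightarrow>
     (\<forall>g\<in>carrier G. \<rho> g \<in> carrier_mat d d) \<and>
     \<rho> (\<one>\<^bsub>G\<^esub>) = 1\<^sub>m d \<and>
     (\<forall>g\<in>carrier G. \<forall>h\<in>carrier G. \<rho> (g \<otimes>\<^bsub>G\<^esub> h) = \<rho> g * \<rho> h)"

definition rep_invariant_subspace ::
  "('g, 'b) monoid_scheme \<Rightarrow> nat \<Rightarrow> ('g \<Rightarrow> complex mat) \<Rightarrow> complex vec set \<Rightarrow> bool" where
  "rep_invariant_subspace G d \<rho> W \<longleftrightarrow>
     W \<subseteq> carrier_vec d \<and> 0\<^sub>v d \<in> W \<and>
     (\<forall>v\<in>W. \<forall>w\<in>W. v + w \<in> W) \<and>
     (\<forall>c::complex. \<forall>v\<in>W. c \<cdot>\<^sub>v v \<in> W) \<and>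
     (\<forall>g\<in>carrier G. \<forall>v\<in>W. \<rho> g *\<^sub>v v \<in> W)"

definition irreducible_rep :: "('g, 'b) monoid_scheme \<Rightarrow> nat \<Rightarrow> ('g \<Rightarrow> complex mat) \<Rightarrow> bool" where
  "irreducible_rep G d \<rho> \<longleftrightarrow> is_rep G d \<rho> \<and> 0 < d \<and>
     (\<forall>W. rep_invariant_subspace G d \<rho> W \<longrightarrow> W = {0\<^sub>v d} \<or> W = carrier_vec d)"

definition mat_trace :: "complex mat \<Rightarrow> complex" where
  "mat_trace A = (\<Sum>i<dim_row A. A $$ (i, i))"

definition irr_char :: "('g, 'b) monoid_scheme \<Rightarrow> ('g \<Rightarrow> complex) \<Rightarrow> bool" where
  "irr_char G \<chi> \<longleftrightarrow> (\<exists>d \<rho>. irreducible_rep G d \<rho> \<and> (\<forall>g\<in>carrier G. \<chi> g = mat_trace (\<rho> g)))"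

text \<open>Subfields of the complex numbers (they automatically contain the rationals).\<close>
definition is_subfield :: "complex set \<Rightarrow> bool" where
  "is_subfield F \<longleftrightarrow> 0 \<in> F \<and> 1 \<in> F \<and>
     (\<forall>x\<in>F. \<forall>y\<in>F. x + y \<in> F \<and> x * y \<in> F) \<and>
     (\<forall>x\<in>F. - x \<in> F) \<and> (\<forall>x\<in>F. x \<noteq> 0 \<longrightarrow> inverse x \<in> F)"

definition gen_field :: "complex set \<Rightarrow> complex set" where
  "gen_field S = \<Inter> {F. is_subfield F \<and> S \<subseteq> F}"

definition char_field :: "('g, 'b) monoid_scheme \<Rightarrow> ('g \<Rightarrow> complex) \<Rightarrow> complex set" where
  "char_field G \<chi> = gen_field (\<chi> ` carrier G)"

definition is_basis_over :: "complex set \<Rightarrow> complex set \<Rightarrow> complex set \<Rightarrow> bool" where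
  "is_basis_over F E B \<longleftrightarrow> finite B \<and> B \<subseteq> E \<and>
     (\<forall>c. (\<forall>b\<in>B. c b \<in> F) \<longrightarrow> (\<Sum>b\<in>B. c b * b) = 0 \<longrightarrow> (\<forall>b\<in>B. c b = 0)) \<and>
     E = {\<Sum>b\<in>B. c b * b | c. \<forall>b\<in>B. c b \<in> F}"

definition field_degree :: "complex set \<Rightarrow> complex set \<Rightarrow> nat" where
  "field_degree E F = (LEAST n. \<exists>B. is_basis_over F E B \<and> card B = n)"

end

theory Submission
  imports Defs "HOL-Computational_Algebra.Fundamental_Theorem_Algebra" "HOL-Analysis.Continuum_Not_Denumerable"
    "HOL-Algebra.Multiplicative_Group" "Jordan_Normal_Form.Schur_Decomposition"
begin

text \<open>Let \<open>E = \<rat>(\<chi>)\<close> and let \<open>A\<close> be the Galois group of \<open>E\<close> over \<open>F\<close>. In the regular wreath product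
  \<open>H = G wr A\<close> the base group \<open>G\<^sup>A\<close> has the irreducible character \<open>\<theta> = \<Otimes>\<^sub>t t\<^sup>-\<^sup>1\<chi>\<close>, and \<open>a \<in> A\<close> acts on it by
  permuting coordinates, which is the same as applying the Galois automorphism \<open>a\<close>. The conjugates of
  \<open>\<theta>\<close> are therefore distinct, so inducing \<open>\<theta>\<close> to \<open>H\<close> gives an irreducible character \<open>\<psi>\<close> of degree
  \<open>n \<chi>(1)\<^sup>n\<close>; it vanishes off \<open>G\<^sup>A\<close> and restricts there to the trace of \<open>\<theta>\<close> from \<open>E\<close> to \<open>F\<close>. Conversely, by
  orthogonality an automorphism of \<open>E\<close> fixing \<open>\<psi>\<close> maps \<open>\<theta>\<close> to one of its conjugates under \<open>A\<close> and hence lies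
  in \<open>A\<close>, so \<open>\<psi>\<close> generates all of \<open>F\<close>.

  Irreducibility is handled through Schur's orthogonality relations for matrix entries: they
  characterize irreducible representations, and being polynomial identities they survive both field
  homomorphisms applied to the entries and the wreath product construction.\<close>

section \<open>Extending field homomorphisms\<close>

text \<open>The obstacle: a Galois automorphism of E has to act on a representation whose matrix
  entries may lie outside E and may even be transcendental. Homomorphisms are therefore extended
  from E to countable subfields of the complex numbers, one element at a time; a finite group has
  only finitely many entries to adjoin. The extension step can also avoid one prescribed value at a
  new element. Applied to the identity of F it moves any given element outside F, which is the fixed
  field property on which the Galois part rests. E is stable under homomorphisms because character
  values are sums of roots of unity, all of which are raised to a common power. In the degree of
  \<psi>, the factor n is the index of the base group and the exponent n is the number of tensor
  factors; both are the order of A, which is shown to be [E:F] by bounding all bases from below and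
  building one from a primitive element.\<close>

definition poly_over :: "complex set \<Rightarrow> complex poly set" where
  "poly_over K = {p. \<forall>i. coeff p i \<in> K}"

section \<open>Subfields of the complex numbers and polynomials over them\<close>

locale complex_subfield =
  fixes K :: "complex set"
  assumes complex_subfield: "is_subfield K"
begin

lemma zero_mem [simp]: "0 \<in> K" and one_mem [simp]: "1 \<in> K"
  and add_mem [intro]: "x \<in> K \<Longrightarrow> y \<in> K \<Longrightarrow> x + y \<in> K"
  and mult_mem [intro]: "x \<in> K \<Longrightarrow> y \<in> K \<Longrightarrow> x * y \<in> K"
  and uminus_mem [intro]: "x \<in> K \<Longrightarrow> - x \<in> K"
  using complex_subfield unfolding is_subfield_def by auto

lemma inverse_mem [intro]: "x \<in> K \<Longrightarrow> inverse x \<in> K"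
  using complex_subfield unfolding is_subfield_def by (cases "x = 0") auto

lemma diff_mem [intro]: "x \<in> K \<Longrightarrow> y \<in> K \<Longrightarrow> x - y \<in> K"
  using add_mem[of x "- y"] by auto

lemma divide_mem [intro]: "x \<in> K \<Longrightarrow> y \<in> K \<Longrightarrow> x / y \<in> K"
  unfolding divide_inverse by auto

lemma sum_mem [intro]: "(\<And>i. i \<in> I \<Longrightarrow> f i \<in> K) \<Longrightarrow> sum f I \<in> K"
  by (induction I rule: infinite_finite_induct) auto

lemma prod_mem [intro]: "(\<And>i. i \<in> I \<Longrightarrow> f i \<in> K) \<Longrightarrow> prod f I \<in> K"
  by (induction I rule: infinite_finite_induct) auto

lemma power_mem [intro]: "x \<in> K \<Longrightarrow> x ^ n \<in> K"
  by (induction n) auto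

lemma of_nat_mem [simp]: "of_nat n \<in> K"
  by (induction n) auto

lemma poly_over_0 [simp]: "0 \<in> poly_over K" and poly_over_1 [simp]: "1 \<in> poly_over K"
  and poly_over_add [intro]: "p \<in> poly_over K \<Longrightarrow> q \<in> poly_over K \<Longrightarrow> p + q \<in> poly_over K"
  and poly_over_diff [intro]: "p \<in> poly_over K \<Longrightarrow> q \<in> poly_over K \<Longrightarrow> p - q \<in> poly_over K"
  and poly_over_uminus [intro]: "p \<in> poly_over K \<Longrightarrow> - p \<in> poly_over K"
  and poly_over_mult [intro]: "p \<in> poly_over K \<Longrightarrow> q \<in> poly_over K \<Longrightarrow> p * q \<in> poly_over K"
  and poly_over_monom [intro]: "c \<in> K \<Longrightarrow> monom c n \<in> poly_over K"
  and poly_over_pCons [intro]: "c \<in> K \<Longrightarrow> p \<in> poly_over K \<Longrightarrow> pCons c p \<in> poly_over K"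
  and poly_over_pderiv [intro]: "p \<in> poly_over K \<Longrightarrow> pderiv p \<in> poly_over K"
  unfolding poly_over_def
  by (auto simp: coeff_mult coeff_pderiv coeff_pCons split: nat.splits
      simp flip: of_nat_Suc intro!: sum_mem mult_mem)

text \<open>Long division divides only by \<open>lead_coeff g\<close>, so quotient and remainder
  never leave \<open>K\<close>; the induction cancels one leading term at a time.\<close>

lemma poly_over_division:
  assumes "f \<in> poly_over K" "g \<in> poly_over K" "g \<noteq> 0"
  obtains q r where "q \<in> poly_over K" "r \<in> poly_over K" "f = q * g + r" "r = 0 \<or> degree r < degree g"
proof -
  have "\<exists>q\<in>poly_over K. \<exists>r\<in>poly_over K. f = q * g + r \<and> (r = 0 \<or> degree r < degree g)"
    using assms(1)
  proof (induction "degree f" arbitrary: f rule: less_induct)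
    case less
    show ?case
    proof (cases "f = 0 \<or> degree f < degree g")
      case True
      then show ?thesis
        using less.prems by (intro bexI[of _ 0] bexI[of _ f]) auto
    next
      case False
      define m where "m = monom (lead_coeff f / lead_coeff g) (degree f - degree g)"
      have m: "m \<in> poly_over K"
        using less.prems assms(2) unfolding m_def poly_over_def[of K]
        by (intro poly_over_monom[unfolded poly_over_def]) auto
      have coeff: "coeff (m * g) (degree f) = lead_coeff f"
        using False assms(3) by (simp add: m_def coeff_monom_mult)
      have deg: "degree (m * g) \<le> degree f"
        using False degree_mult_le[of m g] degree_monom_le[of "lead_coeff f / lead_coeff g" "degree f - degree g"]
        by (auto simp: m_def)
      have lt: "f - m * g = 0 \<or> degree (f - m * g) < degree f"
        using coeff by (intro eq_zero_or_degree_less degree_diff_le deg) simp_all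
      have ov: "f - m * g \<in> poly_over K"
        using less.prems m assms(2) by auto
      have "\<exists>q\<in>poly_over K. \<exists>r\<in>poly_over K. f - m * g = q * g + r \<and> (r = 0 \<or> degree r < degree g)"
      proof (cases "f - m * g = 0")
        case True
        then show ?thesis by (intro bexI[of _ 0]) auto
      next
        case False
        then show ?thesis using less.hyps[of "f - m * g"] lt ov by blast
      qed
      then obtain q r where "q \<in> poly_over K" "r \<in> poly_over K" "f - m * g = q * g + r"
        "r = 0 \<or> degree r < degree g" by blast
      then show ?thesis
        using m by (intro bexI[of _ "q + m"] bexI[of _ r]) (auto simp: algebra_simps)
    qed
  qed
  with that show ?thesis by blast
qed

text \<open>A nonzero element of least degree divides all of \<open>I\<close>, because the remainder
  of a division is again in \<open>I\<close>. It serves both for the minimal polynomial of an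
  element and for the polynomials whose image under a homomorphism has a given root.\<close>

lemma poly_over_ideal:
  assumes fn: "f \<in> I" "f \<noteq> 0"
    and sub: "I \<subseteq> poly_over K"
    and ideal: "\<And>p q r. p \<in> I \<Longrightarrow> q \<in> I \<Longrightarrow> r \<in> poly_over K \<Longrightarrow> p - r * q \<in> I"
  obtains m where "m \<in> I" "m \<noteq> 0" "\<And>p. p \<in> I \<Longrightarrow> \<exists>q\<in>poly_over K. p = q * m"
    "\<And>p. p \<in> I \<Longrightarrow> p \<noteq> 0 \<Longrightarrow> degree m \<le> degree p"
proof -
  obtain m where m: "m \<in> I" "m \<noteq> 0" and min: "\<And>p. p \<in> I \<Longrightarrow> p \<noteq> 0 \<Longrightarrow> degree m \<le> degree p"
    using fn exists_least_iff[of "\<lambda>n. \<exists>m\<in>I. m \<noteq> 0 \<and> degree m = n"] by (metis not_le)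
  have "\<exists>q\<in>poly_over K. p = q * m" if p: "p \<in> I" for p
  proof -
    obtain q r where qr: "q \<in> poly_over K" "p = q * m + r" "r = 0 \<or> degree r < degree m"
      using poly_over_division[of p m] p m sub by blast
    have "r = p - q * m" using qr by simp
    then have "r \<in> I" using ideal p m qr by blast
    then have "r = 0" using min[of r] qr by linarith
    with qr show ?thesis by auto
  qed
  with m min that show ?thesis by blast
qed

end

lemma countable_poly_over:
  assumes "countable K"
  shows "countable (poly_over K)"
proof -
  have "poly_over K \<subseteq> Poly ` lists K"
  proof
    fix p assume "p \<in> poly_over K"
    then have "coeffs p \<in> lists K" unfolding poly_over_def by (auto simp: coeffs_def)
    then show "p \<in> Poly ` lists K" by (metis Poly_coeffs imageI)
  qed
  then show ?thesis by (rule countable_subset) (simp add: assms)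
qed

text \<open>A homomorphism is a total function of which only the values on \<open>K\<close> matter.
  Its target is the whole complex field, and \<open>\<phi> 1 = 1\<close> rules out the zero
  map.\<close>

definition field_hom_on :: "complex set \<Rightarrow> (complex \<Rightarrow> complex) \<Rightarrow> bool" where
  "field_hom_on K \<phi> \<longleftrightarrow> \<phi> 1 = 1 \<and> (\<forall>x\<in>K. \<forall>y\<in>K. \<phi> (x + y) = \<phi> x + \<phi> y \<and> \<phi> (x * y) = \<phi> x * \<phi> y)"

locale subfield_hom = complex_subfield +
  fixes \<phi> :: "complex \<Rightarrow> complex"
  assumes subfield_hom: "field_hom_on K \<phi>"
begin

lemma hom_1 [simp]: "\<phi> 1 = 1"
  and hom_add: "x \<in> K \<Longrightarrow> y \<in> K \<Longrightarrow> \<phi> (x + y) = \<phi> x + \<phi> y"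
  and hom_mult: "x \<in> K \<Longrightarrow> y \<in> K \<Longrightarrow> \<phi> (x * y) = \<phi> x * \<phi> y"
  using subfield_hom unfolding field_hom_on_def by auto

lemma hom_0 [simp]: "\<phi> 0 = 0"
  using hom_add[of 0 0] by simp

lemma hom_uminus: "x \<in> K \<Longrightarrow> \<phi> (- x) = - \<phi> x"
  using hom_add[of x "- x"] uminus_mem[of x] by (simp add: add_eq_0_iff)

lemma hom_diff: "x \<in> K \<Longrightarrow> y \<in> K \<Longrightarrow> \<phi> (x - y) = \<phi> x - \<phi> y"
  using hom_add[of x "- y"] uminus_mem[of y] by (simp add: hom_uminus)

lemma hom_inverse: "x \<in> K \<Longrightarrow> \<phi> (inverse x) = inverse (\<phi> x)"
  using hom_mult[of x "inverse x"] inverse_mem[of x]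
  by (cases "x = 0") (auto simp: inverse_unique)

lemma hom_divide: "x \<in> K \<Longrightarrow> y \<in> K \<Longrightarrow> \<phi> (x / y) = \<phi> x / \<phi> y"
  unfolding divide_inverse using inverse_mem[of y] by (simp add: hom_mult hom_inverse)

lemma hom_eq_0_iff [simp]: "x \<in> K \<Longrightarrow> \<phi> x = 0 \<longleftrightarrow> x = 0"
  using hom_mult[of x "inverse x"] inverse_mem[of x] by (cases "x = 0") auto

lemma hom_inj: "inj_on \<phi> K"
  by (rule inj_onI) (metis diff_mem hom_diff hom_eq_0_iff right_minus_eq)

lemma hom_sum: "(\<And>i. i \<in> I \<Longrightarrow> f i \<in> K) \<Longrightarrow> \<phi> (sum f I) = (\<Sum>i\<in>I. \<phi> (f i))"
  by (induction I rule: infinite_finite_induct) (auto simp: hom_add sum_mem)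

lemma hom_prod: "(\<And>i. i \<in> I \<Longrightarrow> f i \<in> K) \<Longrightarrow> \<phi> (prod f I) = (\<Prod>i\<in>I. \<phi> (f i))"
  by (induction I rule: infinite_finite_induct) (auto simp: hom_mult prod_mem)

lemma hom_power: "x \<in> K \<Longrightarrow> \<phi> (x ^ n) = \<phi> x ^ n"
  by (induction n) (auto simp: hom_mult power_mem)

lemma hom_of_nat [simp]: "\<phi> (of_nat n) = of_nat n"
  by (induction n) (auto simp: hom_add)

lemma image_subfield: "is_subfield (\<phi> ` K)"
  unfolding is_subfield_def
proof (intro conjI ballI impI)
  show "0 \<in> \<phi> ` K" "1 \<in> \<phi> ` K" using imageI[OF zero_mem, of \<phi>] imageI[OF one_mem, of \<phi>] by auto
  fix a assume "a \<in> \<phi> ` K"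
  then obtain x where x: "x \<in> K" "a = \<phi> x" by blast
  show "- a \<in> \<phi> ` K" "inverse a \<in> \<phi> ` K"
    using imageI[OF uminus_mem[OF x(1)], of \<phi>] imageI[OF inverse_mem[OF x(1)], of \<phi>] x
    by (simp_all add: hom_uminus hom_inverse)
  fix b assume "b \<in> \<phi> ` K"
  then obtain y where y: "y \<in> K" "b = \<phi> y" by blast
  show "a + b \<in> \<phi> ` K" "a * b \<in> \<phi> ` K"
    using imageI[OF add_mem[OF x(1) y(1)], of \<phi>] imageI[OF mult_mem[OF x(1) y(1)], of \<phi>] x y
    by (simp_all add: hom_add hom_mult)
qed

lemma coeff_map_hom [simp]: "coeff (map_poly \<phi> p) i = \<phi> (coeff p i)"
  by (simp add: coeff_map_poly)

lemma map_hom_add: "p \<in> poly_over K \<Longrightarrow> q \<in> poly_over K \<Longrightarrow> map_poly \<phi> (p + q) = map_poly \<phi> p + map_poly \<phi> q"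
  and map_hom_diff: "p \<in> poly_over K \<Longrightarrow> q \<in> poly_over K \<Longrightarrow> map_poly \<phi> (p - q) = map_poly \<phi> p - map_poly \<phi> q"
  and map_hom_mult: "p \<in> poly_over K \<Longrightarrow> q \<in> poly_over K \<Longrightarrow> map_poly \<phi> (p * q) = map_poly \<phi> p * map_poly \<phi> q"
  and map_hom_pderiv: "p \<in> poly_over K \<Longrightarrow> map_poly \<phi> (pderiv p) = pderiv (map_poly \<phi> p)"
     apply (auto simp: poly_eq_iff poly_over_def hom_add hom_diff)
   apply (subst coeff_mult, subst coeff_mult)
   apply (subst hom_sum)
    apply (auto simp: hom_mult)[2]
  apply (auto simp: coeff_pderiv hom_mult simp del: of_nat_Suc)
  done

lemma map_hom_eq_0_iff: "p \<in> poly_over K \<Longrightarrow> map_poly \<phi> p = 0 \<longleftrightarrow> p = 0"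
  unfolding poly_eq_iff poly_over_def by (simp only: coeff_map_hom coeff_0 mem_Collect_eq hom_eq_0_iff)

lemma degree_map_hom: "p \<in> poly_over K \<Longrightarrow> degree (map_poly \<phi> p) = degree p"
proof (rule antisym)
  show "degree (map_poly \<phi> p) \<le> degree p" by (rule degree_le) (simp add: coeff_eq_0)
  assume "p \<in> poly_over K"
  then show "degree p \<le> degree (map_poly \<phi> p)"
    by (cases "p = 0") (auto simp: poly_over_def intro: le_degree)
qed

lemma poly_map_hom: "p \<in> poly_over K \<Longrightarrow> x \<in> K \<Longrightarrow> poly (map_poly \<phi> p) (\<phi> x) = \<phi> (poly p x)"
  unfolding poly_altdef
  by (simp add: degree_map_hom hom_sum hom_mult hom_power power_mem mult_mem poly_over_def)

text \<open>From left to right, \<open>p\<close> is a multiple of \<open>m\<close>. For the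
  converse, let \<open>m'\<close> generate the polynomials whose image vanishes at \<open>y\<close>,
  so that \<open>m = q * m'\<close>. Since \<open>m'\<close> is not constant, minimality of
  \<open>m\<close> prevents \<open>q\<close> from vanishing at \<open>x\<close>; hence
  \<open>m'\<close> vanishes there, and with it all its multiples. The equivalence is what makes
  sending \<open>x\<close> to \<open>y\<close> well defined.\<close>

lemma minimal_poly_root_iff:
  assumes m: "m \<in> poly_over K" "m \<noteq> 0" "poly m x = 0"
    and min: "\<And>p. p \<in> poly_over K \<Longrightarrow> p \<noteq> 0 \<Longrightarrow> poly p x = 0 \<Longrightarrow> degree m \<le> degree p"
    and y: "poly (map_poly \<phi> m) y = 0"
    and p: "p \<in> poly_over K"
  shows "poly p x = 0 \<longleftrightarrow> poly (map_poly \<phi> p) y = 0"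
proof
  assume px: "poly p x = 0"
  obtain q r where qr: "q \<in> poly_over K" "r \<in> poly_over K" "p = q * m + r" "r = 0 \<or> degree r < degree m"
    using poly_over_division[of p m] p m by blast
  have "poly r x = 0" using px qr m by auto
  then have "r = 0" using min[of r] qr by linarith
  then show "poly (map_poly \<phi> p) y = 0" using qr y m by (simp add: map_hom_mult)
next
  assume py: "poly (map_poly \<phi> p) y = 0"
  define I where "I = {p \<in> poly_over K. poly (map_poly \<phi> p) y = 0}"
  have ideal: "p - r * q \<in> I" if "p \<in> I" "q \<in> I" "r \<in> poly_over K" for p q r
  proof -
    have "map_poly \<phi> (p - r * q) = map_poly \<phi> p - map_poly \<phi> r * map_poly \<phi> q"
      using that poly_over_mult[of r q] by (simp add: I_def map_hom_diff map_hom_mult)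
    then show ?thesis using that by (auto simp: I_def)
  qed
  obtain m' where m': "m' \<in> I" "m' \<noteq> 0" and dvd: "\<And>p. p \<in> I \<Longrightarrow> \<exists>q\<in>poly_over K. p = q * m'"
  proof -
    have "m \<in> I" "I \<subseteq> poly_over K" using m y by (auto simp: I_def)
    with \<open>m \<noteq> 0\<close> show thesis using that poly_over_ideal[of m I] ideal by metis
  qed
  obtain q where q: "q \<in> poly_over K" "m = q * m'"
    using dvd[of m] m y by (auto simp: I_def)
  have m'over: "m' \<in> poly_over K" using m' by (simp add: I_def)
  have "degree m' \<noteq> 0"
  proof
    assume "degree m' = 0"
    then obtain c where c: "m' = [:c:]" using degree_eq_zeroE by blast
    then have "c \<in> K" "c \<noteq> 0" using m'over m' by (auto simp: poly_over_def coeff_pCons split: nat.splits dest: spec[of _ 0])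
    then show False using m' c by (simp add: I_def map_poly_pCons)
  qed
  moreover have "degree m = degree q + degree m'" and "q \<noteq> 0"
    using q m m' by (auto simp: degree_mult_eq)
  ultimately have "poly q x \<noteq> 0" using min[of q] q by auto
  then have "poly m' x = 0" using m q by auto
  then show "poly p x = 0" using dvd[of p] p py by (auto simp: I_def)
qed

text \<open>If \<open>x\<close> is algebraic over \<open>K\<close>, then \<open>y\<close> is a root of the transported minimal polynomial, which has at
  least two roots; otherwise countability of \<open>K\<close> leaves room for a transcendental \<open>y\<close>.\<close>

lemma exists_conjugate_ne:
  assumes "countable K" and "x \<notin> K"
  obtains y where "y \<noteq> z" "\<And>p. p \<in> poly_over K \<Longrightarrow> poly p x = 0 \<longleftrightarrow> poly (map_poly \<phi> p) y = 0"
proof (cases "\<exists>p\<in>poly_over K. p \<noteq> 0 \<and> poly p x = 0")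
  case False
  have "countable (\<Union>p\<in>poly_over K - {0}. {y. poly (map_poly \<phi> p) y = 0})"
    using countable_poly_over[OF assms(1)]
    by (intro countable_UN) (auto intro!: countable_finite poly_roots_finite simp: map_hom_eq_0_iff)
  then have "countable (insert z (\<Union>p\<in>poly_over K - {0}. {y. poly (map_poly \<phi> p) y = 0}))"
    by simp
  \<comment> \<open>The countable exceptional set is pulled back to the real line, where
    uncountability provides a point outside it.\<close>
  then have "countable (of_real -` insert z (\<Union>p\<in>poly_over K - {0}. {y. poly (map_poly \<phi> p) y = 0}) :: real set)"
    unfolding vimage_def by (rule countable_image_inj) (simp add: inj_on_def)
  then obtain t :: real where
    "complex_of_real t \<notin> insert z (\<Union>p\<in>poly_over K - {0}. {y. poly (map_poly \<phi> p) y = 0})"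
    using uncountable_UNIV_real by (metis UNIV_eq_I vimageI2)
  then obtain y where "y \<notin> insert z (\<Union>p\<in>poly_over K - {0}. {y. poly (map_poly \<phi> p) y = 0})"
    by blast
  then have y: "y \<noteq> z" "\<And>p. p \<in> poly_over K \<Longrightarrow> p \<noteq> 0 \<Longrightarrow> poly (map_poly \<phi> p) y \<noteq> 0" by auto
  show ?thesis
  proof (rule that[OF y(1)])
    fix p assume "p \<in> poly_over K"
    then show "poly p x = 0 \<longleftrightarrow> poly (map_poly \<phi> p) y = 0" using False y by (cases "p = 0") auto
  qed
next
  case True
  define I where "I = {p \<in> poly_over K. poly p x = 0}"
  have ideal: "p - r * q \<in> I" if "p \<in> I" "q \<in> I" "r \<in> poly_over K" for p q r
    using that by (auto simp: I_def)
  obtain m where "m \<in> I" and m0: "m \<noteq> 0"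
    and min': "\<And>p. p \<in> I \<Longrightarrow> p \<noteq> 0 \<Longrightarrow> degree m \<le> degree p"
  proof -
    have "I \<subseteq> poly_over K" by (auto simp: I_def)
    moreover obtain f where "f \<in> I" "f \<noteq> 0" using True by (auto simp: I_def)
    ultimately show thesis using that poly_over_ideal[of f I] ideal by metis
  qed
  then have m: "m \<in> poly_over K" "poly m x = 0" and
    min: "\<And>p. p \<in> poly_over K \<Longrightarrow> p \<noteq> 0 \<Longrightarrow> poly p x = 0 \<Longrightarrow> degree m \<le> degree p"
    by (auto simp: I_def)
  have iff: "poly p x = 0 \<longleftrightarrow> poly (map_poly \<phi> p) y = 0"
    if "poly (map_poly \<phi> m) y = 0" "p \<in> poly_over K" for p y
    using m m0 min that by (intro minimal_poly_root_iff) blast+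
  \<comment> \<open>A linear \<open>m\<close> would put \<open>x\<close> into
    \<open>K\<close>.\<close>
  have deg: "degree m \<ge> 2"
  proof (rule ccontr)
    assume "\<not> ?thesis"
    then have "m = [:coeff m 0, coeff m 1:]"
      by (intro poly_eqI) (auto simp: coeff_pCons coeff_eq_0 split: nat.splits)
    then obtain a b where ab: "m = [:a, b:]" by blast
    have "coeff m 0 \<in> K" "coeff m 1 \<in> K" using m by (auto simp: poly_over_def)
    then have K: "a \<in> K" "b \<in> K" using ab by auto
    have "b \<noteq> 0" using m m0 ab by auto
    then have "x = - a / b" using m ab by (simp add: field_simps add_eq_0_iff)
    then show False using K assms(2) by auto
  qed
  have dm: "degree (map_poly \<phi> m) = degree m" using m degree_map_hom by auto
  then obtain y where y: "poly (map_poly \<phi> m) y = 0"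
    using fundamental_theorem_of_algebra[of "map_poly \<phi> m"] deg
    by (metis constant_degree not_numeral_le_zero)
  then obtain Q where Q: "map_poly \<phi> m = [:- y, 1:] * Q" using poly_eq_0_iff_dvd by (metis dvdE)
  then have "Q \<noteq> 0" using deg dm by auto
  then have "degree (map_poly \<phi> m) = 1 + degree Q" unfolding Q by (subst degree_mult_eq) auto
  then have "degree Q \<noteq> 0" using deg dm by simp
  then obtain y2 where y2: "poly Q y2 = 0"
    using fundamental_theorem_of_algebra[of Q] by (metis constant_degree)
  \<comment> \<open>Separability in characteristic zero: at a double root the derivative of the
    image vanishes too, so by \<open>iff\<close> the nonzero polynomial \<open>pderiv m\<close>, of
    smaller degree than \<open>m\<close>, would vanish at \<open>x\<close>.\<close>
  have "y \<noteq> y2"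
  proof
    assume "y = y2"
    then have "poly (pderiv (map_poly \<phi> m)) y = 0"
      unfolding Q pderiv_mult using y2 by (simp del: mult_pCons_left add: pderiv_pCons)
    then have "poly (pderiv m) x = 0" using iff[OF y, of "pderiv m"] m by (auto simp: map_hom_pderiv)
    moreover have "degree (pderiv m) < degree m" "pderiv m \<noteq> 0"
      using deg by (auto simp: degree_pderiv pderiv_eq_0_iff)
    ultimately show False using min[of "pderiv m"] m by auto
  qed
  moreover have "poly (map_poly \<phi> m) y2 = 0" unfolding Q using y2 by simp
  ultimately consider "y \<noteq> z" | "y2 \<noteq> z" "poly (map_poly \<phi> m) y2 = 0" by metis
  then show ?thesis
  proof cases
    case 1
    show ?thesis by (rule that[OF 1]) (rule iff[OF y])
  next
    case 2
    show ?thesis by (rule that[OF 2(1)]) (rule iff[OF 2(2)])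
  qed
qed

text \<open>For a new \<open>x\<close>, \<open>L\<close> is K(x), written as the values at
  \<open>x\<close> of fractions p/q, and \<open>\<psi>\<close> evaluates the transported fraction at
  a conjugate \<open>y\<close>. Cross-multiplication reduces well-definedness to the root
  equivalence of \<open>x\<close> and \<open>y\<close>. The parameter \<open>z\<close> is a value
  that \<open>\<psi> x\<close> has to avoid; countability of \<open>L\<close> permits
  repetition.\<close>

lemma extend_hom:
  assumes "countable K"
  obtains L \<psi> where "is_subfield L" "countable L" "K \<subseteq> L" "x \<in> L" "field_hom_on L \<psi>"
    "\<And>k. k \<in> K \<Longrightarrow> \<psi> k = \<phi> k" "x \<notin> K \<Longrightarrow> \<psi> x \<noteq> z"
proof (cases "x \<in> K")
  case True
  then show ?thesis using assms complex_subfield subfield_hom by (intro that[of K \<phi>]) simp_all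
next
  case False
  then obtain y where y: "y \<noteq> z" and iff: "\<And>p. p \<in> poly_over K \<Longrightarrow> poly p x = 0 \<longleftrightarrow> poly (map_poly \<phi> p) y = 0"
    by (rule exists_conjugate_ne[OF assms, where z = z]) blast
  define D where "D = {(p, q). p \<in> poly_over K \<and> q \<in> poly_over K \<and> poly q x \<noteq> 0}"
  define v where "v = (\<lambda>(p, q). poly p x / poly q x)"
  define w where "w = (\<lambda>(p, q). poly (map_poly \<phi> p) y / poly (map_poly \<phi> q) y)"
  have wd: "w d = w d'" if "d \<in> D" "d' \<in> D" "v d = v d'" for d d'
  proof -
    obtain p q p' q' where d: "d = (p, q)" "d' = (p', q')" by fastforce
    have ov: "p \<in> poly_over K" "q \<in> poly_over K" "p' \<in> poly_over K" "q' \<in> poly_over K"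
      and nz: "poly q x \<noteq> 0" "poly q' x \<noteq> 0" using that d by (auto simp: D_def)
    have nz': "poly (map_poly \<phi> q) y \<noteq> 0" "poly (map_poly \<phi> q') y \<noteq> 0" using nz iff ov by auto
    have "poly (p * q' - p' * q) x = 0" using that(3) nz by (simp add: v_def d field_simps)
    moreover have "p * q' - p' * q \<in> poly_over K" using ov by (intro poly_over_diff poly_over_mult)
    ultimately have "poly (map_poly \<phi> (p * q' - p' * q)) y = 0" using iff by metis
    moreover have "map_poly \<phi> (p * q' - p' * q) = map_poly \<phi> p * map_poly \<phi> q' - map_poly \<phi> p' * map_poly \<phi> q"
      using ov poly_over_mult by (simp add: map_hom_diff map_hom_mult)
    ultimately show ?thesis using nz' by (simp add: w_def d field_simps)
  qed
  define L where "L = v ` D"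
  define \<psi> where "\<psi> = (\<lambda>l. w (SOME d. d \<in> D \<and> v d = l))"
  have \<psi>: "\<psi> (v d) = w d" if "d \<in> D" for d
    unfolding \<psi>_def using that wd[of _ d] someI[of "\<lambda>d'. d' \<in> D \<and> v d' = v d" d] by blast
  have add: "(p * q' + p' * q, q * q') \<in> D" "v (p * q' + p' * q, q * q') = v (p, q) + v (p', q')"
    "w (p * q' + p' * q, q * q') = w (p, q) + w (p', q')"
    and mult: "(p * p', q * q') \<in> D" "v (p * p', q * q') = v (p, q) * v (p', q')"
    "w (p * p', q * q') = w (p, q) * w (p', q')"
    if "(p, q) \<in> D" "(p', q') \<in> D" for p q p' q'
  proof -
    have ov: "p \<in> poly_over K" "q \<in> poly_over K" "p' \<in> poly_over K" "q' \<in> poly_over K"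
      and nz: "poly q x \<noteq> 0" "poly q' x \<noteq> 0" using that by (auto simp: D_def)
    have nz': "poly (map_poly \<phi> q) y \<noteq> 0" "poly (map_poly \<phi> q') y \<noteq> 0" using nz iff ov by auto
    show "(p * q' + p' * q, q * q') \<in> D" "(p * p', q * q') \<in> D"
      using ov nz by (auto simp: D_def)
    show "v (p * q' + p' * q, q * q') = v (p, q) + v (p', q')" "v (p * p', q * q') = v (p, q) * v (p', q')"
      using nz by (simp_all add: v_def add_frac_eq)
    show "w (p * q' + p' * q, q * q') = w (p, q) + w (p', q')" "w (p * p', q * q') = w (p, q) * w (p', q')"
      using ov nz' poly_over_mult by (simp_all add: w_def map_hom_mult map_hom_add add_frac_eq)
  qed
  have "map_poly \<phi> [:k:] = [:\<phi> k:]" for k by (rule poly_eqI) (auto simp: coeff_pCons split: nat.splits)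
  then have const: "([:k:], 1) \<in> D" "v ([:k:], 1) = k" "w ([:k:], 1) = \<phi> k" if "k \<in> K" for k
    using that by (auto simp: D_def v_def w_def)
  have "[:0, 1:] \<in> poly_over K" by (intro poly_over_pCons) auto
  then have X: "([:0, 1:], 1) \<in> D" "v ([:0, 1:], 1) = x" "w ([:0, 1:], 1) = y"
    by (auto simp: D_def v_def w_def map_poly_pCons map_poly_1)
  have KL: "K \<subseteq> L" using const by (force simp: L_def)
  have "is_subfield L"
    unfolding is_subfield_def
  proof (intro conjI ballI impI)
    show "0 \<in> L" "1 \<in> L" using KL by auto
    fix a assume "a \<in> L"
    then obtain p q where a: "(p, q) \<in> D" "a = v (p, q)" by (auto simp: L_def)
    have "(- p, q) \<in> D" "- a = v (- p, q)" using a by (auto simp: D_def v_def)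
    then show "- a \<in> L" by (auto simp: L_def)
    { assume "a \<noteq> 0"
      then have "(q, p) \<in> D" "inverse a = v (q, p)" using a by (auto simp: D_def v_def)
      then show "inverse a \<in> L" by (auto simp: L_def) }
    fix b assume "b \<in> L"
    then obtain p' q' where b: "(p', q') \<in> D" "b = v (p', q')" by (auto simp: L_def)
    show "a + b \<in> L" using add(1,2)[OF a(1) b(1)] a b by (metis L_def imageI)
    show "a * b \<in> L" using mult(1,2)[OF a(1) b(1)] a b by (metis L_def imageI)
  qed
  moreover have "countable L"
  proof -
    have "D \<subseteq> poly_over K \<times> poly_over K" by (auto simp: D_def)
    then have "countable D" using countable_poly_over[OF assms] by (meson countable_SIGMA countable_subset)
    then show ?thesis by (simp add: L_def)
  qed
  moreover have "field_hom_on L \<psi>"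
    unfolding field_hom_on_def
  proof (intro conjI ballI)
    show "\<psi> 1 = 1" using \<psi>[OF const(1)[of 1]] const[of 1] by simp
    fix a b assume "a \<in> L" "b \<in> L"
    then obtain p q p' q' where ab: "(p, q) \<in> D" "a = v (p, q)" "(p', q') \<in> D" "b = v (p', q')"
      by (auto simp: L_def)
    show "\<psi> (a + b) = \<psi> a + \<psi> b" using add[OF ab(1,3)] ab by (metis \<psi>)
    show "\<psi> (a * b) = \<psi> a * \<psi> b" using mult[OF ab(1,3)] ab by (metis \<psi>)
  qed
  moreover have "x \<in> L" "\<psi> x = y" using X \<psi>[OF X(1)] by (auto simp: L_def intro: rev_image_eqI)
  moreover have "\<psi> k = \<phi> k" if "k \<in> K" for k using \<psi>[OF const(1)[OF that]] const[OF that] by simp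
  ultimately show ?thesis using KL y by (intro that[of L \<psi>]) simp_all
qed

text \<open>Generators are adjoined one by one. The invariant includes countability, on which the
  treatment of a transcendental generator depends.\<close>

lemma extend_hom_finite:
  assumes "countable K" and "finite S"
  obtains L \<psi> where "is_subfield L" "countable L" "K \<subseteq> L" "S \<subseteq> L" "field_hom_on L \<psi>"
    "\<And>k. k \<in> K \<Longrightarrow> \<psi> k = \<phi> k"
proof -
  have "\<exists>L \<psi>. is_subfield L \<and> countable L \<and> K \<subseteq> L \<and> S \<subseteq> L \<and> field_hom_on L \<psi> \<and> (\<forall>k\<in>K. \<psi> k = \<phi> k)"
    using assms(2)
  proof (induction S)
    case empty
    show ?case using assms complex_subfield subfield_hom by (intro exI[of _ K] exI[of _ \<phi>]) auto
  next
    case (insert x S)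
    then obtain L \<psi> where L: "is_subfield L" "countable L" "K \<subseteq> L" "S \<subseteq> L" "field_hom_on L \<psi>" "\<forall>k\<in>K. \<psi> k = \<phi> k"
      by blast
    then interpret L: subfield_hom L \<psi> by unfold_locales
    obtain M \<chi> where "is_subfield M" "countable M" "L \<subseteq> M" "x \<in> M" "field_hom_on M \<chi>" "\<And>k. k \<in> L \<Longrightarrow> \<chi> k = \<psi> k"
      by (rule L.extend_hom[OF L(2), of x]) blast
    then show ?case using L by (intro exI[of _ M] exI[of _ \<chi>]) auto
  qed
  with that show ?thesis by blast
qed

end

section \<open>Galois theory of normal subfields of the complex numbers\<close>

lemma gen_field_superset: "S \<subseteq> gen_field S"
  unfolding gen_field_def by blast

lemma gen_field_least: "is_subfield L \<Longrightarrow> S \<subseteq> L \<Longrightarrow> gen_field S \<subseteq> L"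
  unfolding gen_field_def by blast

lemma is_subfield_gen_field: "is_subfield (gen_field S)"
  unfolding gen_field_def is_subfield_def by blast

lemma is_subfield_Rats: "is_subfield \<rat>"
  unfolding is_subfield_def by auto

lemma field_hom_on_id: "field_hom_on K (\<lambda>x. x)"
  unfolding field_hom_on_def by simp

lemma field_hom_on_subset: "field_hom_on L \<phi> \<Longrightarrow> K \<subseteq> L \<Longrightarrow> field_hom_on K \<phi>"
  unfolding field_hom_on_def by blast

lemma field_hom_on_cong: "(\<And>x. x \<in> K \<Longrightarrow> \<phi> x = \<psi> x) \<Longrightarrow> is_subfield K \<Longrightarrow> field_hom_on K \<phi> \<longleftrightarrow> field_hom_on K \<psi>"
  unfolding field_hom_on_def is_subfield_def by (auto 0 3)

lemma field_hom_on_comp: "field_hom_on K \<psi> \<Longrightarrow> \<psi> ` K \<subseteq> L \<Longrightarrow> field_hom_on L \<phi> \<Longrightarrow> field_hom_on K (\<phi> \<circ> \<psi>)"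
  unfolding field_hom_on_def by (auto simp: image_subset_iff)

text \<open>The extension lemma is used here as a source of countable fields: extending the identity
  of the rationals to \<open>S\<close> yields one that contains \<open>S\<close>.\<close>

lemma countable_gen_field:
  assumes "finite S"
  shows "countable (gen_field S)"
proof -
  interpret Q: subfield_hom "\<rat>" "\<lambda>x. x"
    by unfold_locales (rule is_subfield_Rats field_hom_on_id)+
  obtain L where L: "is_subfield L" "countable L" "S \<subseteq> L"
    by (rule Q.extend_hom_finite[OF countable_rat assms]) blast
  from gen_field_least[OF L(1,3)] L(2) show ?thesis by (rule countable_subset)
qed

section \<open>Polynomial interpolation and linear systems\<close>

lemma poly_eq_0_if_many_roots:
  assumes "finite A" and "\<And>i. i \<ge> card A \<Longrightarrow> coeff p i = 0" and "\<And>a. a \<in> A \<Longrightarrow> poly p a = 0"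
  shows "p = (0 :: 'a::idom poly)"
proof (rule ccontr)
  assume p: "p \<noteq> 0"
  have "card A \<le> card {x. poly p x = 0}"
    using assms(3) by (intro card_mono poly_roots_finite[OF p]) auto
  also have "\<dots> \<le> degree p" by (rule card_poly_roots_bound[OF p])
  finally have "lead_coeff p = 0" by (rule assms(2))
  with p show False by simp
qed

text \<open>Newton interpolation: the value at a new node is corrected by a multiple of the
  polynomial \<open>m\<close> that vanishes exactly at the old nodes. The degree bound is phrased
  through coefficients so that it also makes sense for an empty set of nodes.\<close>

lemma interpolation_poly_exists:
  fixes f :: "'a::field \<Rightarrow> 'a"
  assumes "finite A"
  shows "\<exists>p. (\<forall>i\<ge>card A. coeff p i = 0) \<and> (\<forall>a\<in>A. poly p a = f a)"
  using assms
proof (induction A)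
  case empty
  show ?case by (intro exI[of _ 0]) simp
next
  case (insert b A)
  then obtain p where p: "\<forall>i\<ge>card A. coeff p i = 0" "\<forall>a\<in>A. poly p a = f a" by blast
  define m where "m = (\<Prod>a\<in>A. [:- a, 1:])"
  have deg: "degree m = card A"
    unfolding m_def by (subst degree_prod_eq_sum_degree) auto
  have roots: "poly m a = 0 \<longleftrightarrow> a \<in> A" for a
    unfolding m_def poly_prod using insert(1) by auto
  define q where "q = p + smult ((f b - poly p b) / poly m b) m"
  have "coeff q i = 0" if "i \<ge> Suc (card A)" for i
    using that p(1) deg by (auto simp: q_def coeff_eq_0)
  moreover have "poly q a = f a" if "a \<in> insert b A" for a
    using that p(2) roots[of a] insert(2) by (auto simp: q_def)
  ultimately show ?case using insert by (intro exI[of _ q]) simp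
qed

text \<open>Gaussian elimination: an unknown \<open>a0\<close> with nonzero coefficient in equation
  \<open>b\<close> is eliminated from the others, which leaves one equation and one unknown
  fewer.\<close>

lemma underdetermined_solution_exists:
  fixes M :: "'b \<Rightarrow> 'a \<Rightarrow> 'c::field"
  assumes "finite B" and "finite A" and "card B < card A"
  shows "\<exists>y. (\<exists>a\<in>A. y a \<noteq> 0) \<and> (\<forall>b\<in>B. (\<Sum>a\<in>A. M b a * y a) = 0)"
  using assms
proof (induction B arbitrary: A M)
  case empty
  then obtain a where "a \<in> A" by fastforce
  then show ?case by (intro exI[of _ "\<lambda>_. 1"]) auto
next
  case (insert b B)
  show ?case
  proof (cases "\<forall>a\<in>A. M b a = 0")
    case True
    obtain y where "\<exists>a\<in>A. y a \<noteq> 0" "\<forall>b\<in>B. (\<Sum>a\<in>A. M b a * y a) = 0"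
      using insert.IH[of A M] insert.hyps insert.prems by (metis card_insert_disjoint Suc_lessD)
    then show ?thesis using True by (intro exI[of _ y]) simp
  next
    case False
    then obtain a0 where a0: "a0 \<in> A" "M b a0 \<noteq> 0" by blast
    define A' where "A' = A - {a0}"
    have A': "finite A'" "A = insert a0 A'" "a0 \<notin> A'" "card B < card A'"
      using insert a0 by (auto simp: A'_def)
    obtain y where y: "\<exists>a\<in>A'. y a \<noteq> 0"
      and sol: "\<forall>b'\<in>B. (\<Sum>a\<in>A'. (M b' a - M b' a0 * M b a / M b a0) * y a) = 0"
      using insert.IH[OF A'(1,4), of "\<lambda>b' a. M b' a - M b' a0 * M b a / M b a0"] by blast
    define s where "s = (\<Sum>a\<in>A'. M b a * y a)"
    \<comment> \<open>The eliminated unknown gets the value that equation \<open>b\<close> forces on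
      it.\<close>
    define z where "z = y(a0 := - s / M b a0)"
    have sum_z: "(\<Sum>a\<in>A. N a * z a) = (\<Sum>a\<in>A'. N a * y a) - N a0 * s / M b a0" for N :: "'a \<Rightarrow> 'c"
    proof -
      have "(\<Sum>a\<in>A'. N a * z a) = (\<Sum>a\<in>A'. N a * y a)"
        using A'(3) by (intro sum.cong) (auto simp: z_def)
      then show ?thesis using A' by (simp add: z_def)
    qed
    have "(\<Sum>a\<in>A. M b a * z a) = 0" unfolding sum_z using a0 by (simp add: s_def)
    moreover have "(\<Sum>a\<in>A. M b' a * z a) = 0" if "b' \<in> B" for b'
    proof -
      have "(\<Sum>a\<in>A'. (M b' a - M b' a0 * M b a / M b a0) * y a) =
        (\<Sum>a\<in>A'. M b' a * y a) - (\<Sum>a\<in>A'. M b' a0 / M b a0 * (M b a * y a))"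
        unfolding sum_subtractf[symmetric] by (intro sum.cong) (simp_all add: algebra_simps)
      then show ?thesis using sol that unfolding sum_z s_def by (simp add: sum_distrib_left sum_divide_distrib)
    qed
    moreover have "\<exists>a\<in>A. z a \<noteq> 0" using y A' by (auto simp: z_def)
    ultimately show ?thesis by (intro exI[of _ z]) simp
  qed
qed

text \<open>Normality is expressed on a finite generating set: every homomorphism into the complex
  numbers sends generators to generators. For a field of character values this form can be checked
  directly on the values.\<close>

locale normal_field =
  fixes S E :: "complex set"
  assumes finite_gens: "finite S" and E_eq: "E = gen_field S"
    and normal: "\<And>\<phi>. field_hom_on E \<phi> \<Longrightarrow> \<phi> ` S \<subseteq> S"
begin

sublocale complex_subfield E
  by unfold_locales (simp add: E_eq is_subfield_gen_field)

lemma gens_subset: "S \<subseteq> E"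
  unfolding E_eq by (rule gen_field_superset)

lemma E_least: "is_subfield L \<Longrightarrow> S \<subseteq> L \<Longrightarrow> E \<subseteq> L"
  unfolding E_eq by (rule gen_field_least)

lemma countable_E: "countable E"
  unfolding E_eq by (rule countable_gen_field[OF finite_gens])

text \<open>The set on which two homomorphisms agree is a subfield, so it contains \<open>E\<close>
  once it contains \<open>S\<close>.\<close>

lemma hom_eqI:
  assumes "field_hom_on E \<phi>" "field_hom_on E \<psi>" "\<And>s. s \<in> S \<Longrightarrow> \<phi> s = \<psi> s" and "x \<in> E"
  shows "\<phi> x = \<psi> x"
proof -
  interpret p: subfield_hom E \<phi> by unfold_locales (rule assms)
  interpret q: subfield_hom E \<psi> by unfold_locales (rule assms)
  have "is_subfield {x \<in> E. \<phi> x = \<psi> x}"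
    unfolding is_subfield_def
    by (simp add: add_mem mult_mem uminus_mem inverse_mem p.hom_add q.hom_add p.hom_mult q.hom_mult
        p.hom_uminus q.hom_uminus p.hom_inverse q.hom_inverse)
  from E_least[OF this] show ?thesis using assms(3,4) gens_subset by blast
qed

text \<open>An injective map of the finite set \<open>S\<close> into itself is onto, so the image of
  \<open>E\<close>, a subfield, contains every generator.\<close>

lemma hom_image:
  assumes "field_hom_on E \<phi>"
  shows "\<phi> ` E = E"
proof
  interpret p: subfield_hom E \<phi> by unfold_locales (rule assms)
  have "is_subfield {x \<in> E. \<phi> x \<in> E}"
    unfolding is_subfield_def
    by (simp add: add_mem mult_mem uminus_mem inverse_mem p.hom_add p.hom_mult p.hom_uminus p.hom_inverse)
  from E_least[OF this] show "\<phi> ` E \<subseteq> E" using normal[OF assms] gens_subset by blast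
  have "\<phi> ` S = S"
    using finite_gens normal[OF assms] inj_on_subset[OF p.hom_inj gens_subset] by (rule endo_inj_surj)
  then have "S \<subseteq> \<phi> ` E" using image_mono[OF gens_subset, of \<phi>] by simp
  with p.image_subfield show "E \<subseteq> \<phi> ` E" by (rule E_least)
qed

text \<open>Automorphisms of \<open>E\<close> are continued by the identity outside \<open>E\<close>, so that the group operations are
  composition and inversion of functions.\<close>

definition Gal :: "complex set \<Rightarrow> (complex \<Rightarrow> complex) set" where
  "Gal X = {\<sigma>. field_hom_on E \<sigma> \<and> (\<forall>x\<in>X. \<sigma> x = x) \<and> (\<forall>x. x \<notin> E \<longrightarrow> \<sigma> x = x)}"

lemma Gal_hom: "\<sigma> \<in> Gal X \<Longrightarrow> field_hom_on E \<sigma>"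
  and Gal_fix: "\<sigma> \<in> Gal X \<Longrightarrow> x \<in> X \<Longrightarrow> \<sigma> x = x"
  and Gal_outside: "\<sigma> \<in> Gal X \<Longrightarrow> x \<notin> E \<Longrightarrow> \<sigma> x = x"
  unfolding Gal_def by auto

lemma Gal_antimono: "X \<subseteq> Y \<Longrightarrow> Gal Y \<subseteq> Gal X"
  unfolding Gal_def by blast

lemma Gal_field_hom: "\<sigma> \<in> Gal X \<Longrightarrow> subfield_hom E \<sigma>"
  by unfold_locales (rule Gal_hom)

lemma Gal_image: "\<sigma> \<in> Gal X \<Longrightarrow> \<sigma> ` E = E"
  using hom_image Gal_hom by blast

lemma Gal_mem: "\<sigma> \<in> Gal X \<Longrightarrow> x \<in> E \<Longrightarrow> \<sigma> x \<in> E"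
  using Gal_image by blast

lemma Gal_bij: assumes "\<sigma> \<in> Gal X" shows "bij \<sigma>"
proof -
  interpret subfield_hom E \<sigma> using assms by (rule Gal_field_hom)
  have "bij_betw \<sigma> E E" using hom_inj Gal_image[OF assms] by (simp add: bij_betw_def)
  moreover have "bij_betw \<sigma> (- E) (- E)"
    using Gal_outside[OF assms] by (subst bij_betw_cong[of _ _ "\<lambda>x. x"]) (auto simp: bij_betw_def)
  ultimately show ?thesis using bij_betw_combine[of \<sigma> E E "- E" "- E"] by simp
qed

lemma Gal_eqI:
  assumes "\<sigma> \<in> Gal X" "\<tau> \<in> Gal Y" "\<And>s. s \<in> S \<Longrightarrow> \<sigma> s = \<tau> s"
  shows "\<sigma> = \<tau>"
proof
  fix x show "\<sigma> x = \<tau> x"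
    using hom_eqI[OF Gal_hom[OF assms(1)] Gal_hom[OF assms(2)] assms(3)]
      Gal_outside[OF assms(1)] Gal_outside[OF assms(2)]
    by (cases "x \<in> E") auto
qed

text \<open>An automorphism is determined by its restriction to \<open>S\<close>, a map of a finite
  set to itself.\<close>

lemma finite_Gal: "finite (Gal X)"
proof (rule inj_on_finite)
  show "inj_on (\<lambda>\<sigma>. restrict \<sigma> S) (Gal X)"
    by (intro inj_onI Gal_eqI) (auto simp: restrict_def fun_eq_iff, metis)
  show "(\<lambda>\<sigma>. restrict \<sigma> S) ` Gal X \<subseteq> S \<rightarrow>\<^sub>E S"
    using normal[OF Gal_hom] by (auto simp: image_subset_iff)
  show "finite (S \<rightarrow>\<^sub>E S)" using finite_gens by (intro finite_PiE)
qed

lemma id_Gal: "id \<in> Gal X"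
  unfolding Gal_def using field_hom_on_id by (simp add: id_def)

lemma comp_Gal: "\<sigma> \<in> Gal X \<Longrightarrow> \<tau> \<in> Gal X \<Longrightarrow> \<sigma> \<circ> \<tau> \<in> Gal X"
  using field_hom_on_comp[of E \<tau> E \<sigma>] Gal_image[of \<tau> X] by (auto simp: Gal_def)

lemma inv_Gal: assumes "\<sigma> \<in> Gal X" shows "inv_into UNIV \<sigma> \<in> Gal X"
proof -
  interpret subfield_hom E \<sigma> using assms by (rule Gal_field_hom)
  note bij = Gal_bij[OF assms]
  have inv: "inv_into UNIV \<sigma> y = x" if "\<sigma> x = y" for x y
    using that bij by (simp add: bij_is_inj inv_f_eq)
  have "field_hom_on E (inv_into UNIV \<sigma>)"
    unfolding field_hom_on_def
  proof (intro conjI ballI)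
    show "inv_into UNIV \<sigma> 1 = 1" by (rule inv) simp
    fix a b assume "a \<in> E" "b \<in> E"
    then have "a \<in> \<sigma> ` E" "b \<in> \<sigma> ` E" using Gal_image[OF assms] by auto
    then obtain x y where xy: "x \<in> E" "a = \<sigma> x" "y \<in> E" "b = \<sigma> y" by blast
    then have "inv_into UNIV \<sigma> a = x" "inv_into UNIV \<sigma> b = y" using inv by auto
    then show "inv_into UNIV \<sigma> (a + b) = inv_into UNIV \<sigma> a + inv_into UNIV \<sigma> b" "inv_into UNIV \<sigma> (a * b) = inv_into UNIV \<sigma> a * inv_into UNIV \<sigma> b"
      using xy by (auto intro!: inv simp: hom_add hom_mult)
  qed
  then show ?thesis using assms inv unfolding Gal_def by blast
qed

lemma Gal_comp_inv: "\<sigma> \<in> Gal X \<Longrightarrow> \<sigma> \<circ> inv_into UNIV \<sigma> = id"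
  and Gal_inv_comp: "\<sigma> \<in> Gal X \<Longrightarrow> inv_into UNIV \<sigma> \<circ> \<sigma> = id"
  using Gal_bij[of \<sigma> X] by (simp_all add: bij_is_inj bij_is_surj flip: surj_iff)

definition Gal_group :: "complex set \<Rightarrow> (complex \<Rightarrow> complex) monoid" where
  "Gal_group X = \<lparr>carrier = Gal X, mult = (\<circ>), one = id\<rparr>"

lemma Gal_group: "group (Gal_group X)"
proof (rule groupI)
  fix \<sigma> assume "\<sigma> \<in> carrier (Gal_group X)"
  then have s: "\<sigma> \<in> Gal X" by (simp add: Gal_group_def)
  then show "\<exists>\<tau>\<in>carrier (Gal_group X). \<tau> \<otimes>\<^bsub>Gal_group X\<^esub> \<sigma> = \<one>\<^bsub>Gal_group X\<^esub>"
    using inv_Gal[OF s] Gal_inv_comp[OF s] by (auto simp: Gal_group_def)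
qed (auto simp: Gal_group_def id_Gal comp_Gal comp_assoc)

text \<open>Extension produces homomorphisms on fields larger than \<open>E\<close>; replacing them
  by the identity outside \<open>E\<close> brings them into the form of elements of
  \<open>Gal\<close>.\<close>

lemma restrict_Gal:
  assumes "field_hom_on L \<phi>" "E \<subseteq> L" "\<And>x. x \<in> X \<Longrightarrow> \<phi> x = x"
  shows "(\<lambda>z. if z \<in> E then \<phi> z else z) \<in> Gal X"
proof -
  have "field_hom_on E (\<lambda>z. if z \<in> E then \<phi> z else z)"
    using field_hom_on_subset[OF assms(1,2)]
    by (subst field_hom_on_cong[of E _ \<phi>]) (auto simp: complex_subfield)
  then show ?thesis using assms(3) unfolding Gal_def by auto
qed

text \<open>The identity of \<open>F\<close> extends to F(x) with a value other than
  \<open>x\<close> at \<open>x\<close>, and from there to the generators of \<open>E\<close> and to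
  \<open>T\<close>. This is the fixed field property in a form that also covers elements
  \<open>x\<close> not known to lie in \<open>E\<close>, such as the interpolation coefficients in
  \<open>exists_basis\<close>, which are passed as \<open>T\<close>.\<close>

lemma exists_moving_hom:
  assumes F: "is_subfield F" "F \<subseteq> E" and "x \<notin> F" and "finite T"
  obtains L \<phi> where "is_subfield L" "E \<subseteq> L" "x \<in> L" "T \<subseteq> L" "field_hom_on L \<phi>"
    "\<And>k. k \<in> F \<Longrightarrow> \<phi> k = k" "\<phi> x \<noteq> x"
proof -
  interpret F: subfield_hom F "\<lambda>x. x"
    by unfold_locales (rule F field_hom_on_id)+
  have "countable F" using F(2) countable_E by (rule countable_subset)
  then obtain K \<psi> where K: "is_subfield K" "countable K" "F \<subseteq> K" "x \<in> K" "field_hom_on K \<psi>"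
    "\<And>k. k \<in> F \<Longrightarrow> \<psi> k = k" "x \<notin> F \<Longrightarrow> \<psi> x \<noteq> x"
    by (rule F.extend_hom[of x x]) blast
  interpret K: subfield_hom K \<psi> by unfold_locales (rule K)+
  have "finite (S \<union> T)" using finite_gens assms(4) by simp
  then obtain L \<phi> where L: "is_subfield L" "countable L" "K \<subseteq> L" "S \<union> T \<subseteq> L" "field_hom_on L \<phi>"
    "\<And>k. k \<in> K \<Longrightarrow> \<phi> k = \<psi> k"
    by (rule K.extend_hom_finite[OF K(2)]) blast
  show ?thesis
  proof (rule that[of L \<phi>])
    show "E \<subseteq> L" using L(1,4) by (intro E_least) auto
    show "\<phi> x \<noteq> x" using L(6)[OF K(4)] K(7) assms(3) by simp
    show "\<phi> k = k" if "k \<in> F" for k using L(6)[of k] K(3,6) that by auto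
  qed (use L K in auto)
qed

text \<open>Distinct automorphisms differ at some generator \<open>s i\<close>, so the polynomial
  \<open>P \<sigma> \<tau>\<close> is nonzero. Its value at \<open>t\<close> is the difference of
  the images of the sum of all \<open>s i * t ^ i\<close>; hence every natural number outside the
  finitely many roots gives a suitable \<open>\<alpha>\<close>.\<close>

lemma primitive_element:
  obtains \<alpha> where "\<alpha> \<in> E" "inj_on (\<lambda>\<sigma>. \<sigma> \<alpha>) (Gal X)"
proof -
  obtain s where s: "S = s ` {..<card S}" using finite_gens ex_bij_betw_nat_finite[of S]
    by (metis atLeast0LessThan bij_betw_imp_surj_on)
  define P where "P \<sigma> \<tau> = (\<Sum>i<card S. monom (\<sigma> (s i) - \<tau> (s i)) i)" for \<sigma> \<tau> :: "complex \<Rightarrow> complex"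
  define bad where "bad = (\<Union>(\<sigma>, \<tau>) \<in> {(\<sigma>, \<tau>). \<sigma> \<in> Gal X \<and> \<tau> \<in> Gal X \<and> \<sigma> \<noteq> \<tau>}. {t. poly (P \<sigma> \<tau>) t = 0})"
  have "P \<sigma> \<tau> \<noteq> 0" if "\<sigma> \<in> Gal X" "\<tau> \<in> Gal X" "\<sigma> \<noteq> \<tau>" for \<sigma> \<tau>
  proof
    assume "P \<sigma> \<tau> = 0"
    have "\<sigma> (s i) = \<tau> (s i)" if "i < card S" for i
    proof -
      have "coeff (P \<sigma> \<tau>) i = \<sigma> (s i) - \<tau> (s i)"
        using that by (simp add: P_def coeff_sum)
      then show ?thesis using \<open>P \<sigma> \<tau> = 0\<close> by simp
    qed
    then have "\<sigma> u = \<tau> u" if "u \<in> S" for u using s that by (metis imageE lessThan_iff)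
    then have "\<sigma> = \<tau>" by (rule Gal_eqI[OF that(1,2)])
    then show False using that by simp
  qed
  moreover have "finite {(\<sigma>, \<tau>). \<sigma> \<in> Gal X \<and> \<tau> \<in> Gal X \<and> \<sigma> \<noteq> \<tau>}"
    by (rule finite_subset[of _ "Gal X \<times> Gal X"]) (auto simp: finite_Gal)
  ultimately have "finite bad" unfolding bad_def by (intro finite_UN_I) (auto intro: poly_roots_finite)
  moreover have "infinite (range (of_nat :: nat \<Rightarrow> complex))"
    by (rule range_inj_infinite) (simp add: inj_def)
  ultimately have "\<not> range of_nat \<subseteq> bad" using finite_subset by blast
  then obtain t :: nat where t: "of_nat t \<notin> bad" by blast
  define \<alpha> where "\<alpha> = (\<Sum>i<card S. s i * of_nat t ^ i)"
  have sE: "s i \<in> E" if "i < card S" for i using s gens_subset that by blast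
  have apply_alpha: "\<sigma> \<alpha> = (\<Sum>i<card S. \<sigma> (s i) * of_nat t ^ i)" if "\<sigma> \<in> Gal X" for \<sigma>
  proof -
    interpret subfield_hom E \<sigma> using that by (rule Gal_field_hom)
    show ?thesis unfolding \<alpha>_def
      by (subst hom_sum) (auto simp: sE mult_mem power_mem hom_mult hom_power)
  qed
  have "inj_on (\<lambda>\<sigma>. \<sigma> \<alpha>) (Gal X)"
  proof (rule inj_onI, rule ccontr)
    fix \<sigma> \<tau> assume st: "\<sigma> \<in> Gal X" "\<tau> \<in> Gal X" "\<sigma> \<alpha> = \<tau> \<alpha>" "\<sigma> \<noteq> \<tau>"
    have "poly (P \<sigma> \<tau>) (of_nat t) = (\<Sum>i<card S. (\<sigma> (s i) - \<tau> (s i)) * of_nat t ^ i)"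
      by (simp add: P_def poly_sum poly_monom)
    also have "\<dots> = \<sigma> \<alpha> - \<tau> \<alpha>"
      by (simp add: apply_alpha st(1,2) sum_subtractf left_diff_distrib)
    finally have "poly (P \<sigma> \<tau>) (of_nat t) = 0" using st by simp
    then have "of_nat t \<in> bad" unfolding bad_def using st by blast
    with t show False by simp
  qed
  moreover have "\<alpha> \<in> E" unfolding \<alpha>_def by (auto simp: sE mult_mem power_mem intro!: sum_mem)
  ultimately show ?thesis using that by blast
qed

lemma Gal_map_poly:
  assumes "\<sigma> \<in> Gal F" "p \<in> poly_over F" "F \<subseteq> E" "x \<in> E"
  shows "poly p (\<sigma> x) = \<sigma> (poly p x)"
proof -
  interpret subfield_hom E \<sigma> using assms(1) by (rule Gal_field_hom)
  have "map_poly \<sigma> p = p" using assms Gal_fix by (intro poly_eqI) (auto simp: poly_over_def)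
  moreover have "p \<in> poly_over E" using assms by (auto simp: poly_over_def)
  ultimately show ?thesis using poly_map_hom[of p x] assms by simp
qed

text \<open>With fewer basis elements than automorphisms, the automorphisms would be linearly dependent;
  interpolation at the conjugates of a primitive element excludes this.\<close>

lemma card_basis_ge:
  assumes "F \<subseteq> E" and "is_basis_over F E B"
  shows "card (Gal F) \<le> card B"
proof (rule ccontr)
  assume "\<not> ?thesis"
  then have lt: "card B < card (Gal F)" by simp
  have B: "finite B" "B \<subseteq> E" and span: "E = {\<Sum>b\<in>B. c b * b | c. \<forall>b\<in>B. c b \<in> F}"
    using assms unfolding is_basis_over_def by auto
  \<comment> \<open>There is one equation for each basis element and one unknown for each
    automorphism.\<close>
  obtain y \<sigma>0 where y: "\<sigma>0 \<in> Gal F" "y \<sigma>0 \<noteq> 0" and sol: "\<forall>b\<in>B. (\<Sum>\<sigma>\<in>Gal F. \<sigma> b * y \<sigma>) = 0"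
    using underdetermined_solution_exists[OF B(1) finite_Gal lt, of "\<lambda>b \<sigma>. \<sigma> b"] by blast
  have rel: "(\<Sum>\<sigma>\<in>Gal F. \<sigma> z * y \<sigma>) = 0" if "z \<in> E" for z
  proof -
    obtain c where c: "z = (\<Sum>b\<in>B. c b * b)" "\<forall>b\<in>B. c b \<in> F"
      using \<open>z \<in> E\<close> unfolding span by blast
    have "\<sigma> z = (\<Sum>b\<in>B. c b * \<sigma> b)" if "\<sigma> \<in> Gal F" for \<sigma>
    proof -
      interpret subfield_hom E \<sigma> using that by (rule Gal_field_hom)
      have "\<sigma> z = (\<Sum>b\<in>B. \<sigma> (c b * b))"
        unfolding c(1) by (rule hom_sum) (use c(2) B assms(1) in blast)
      also have "\<dots> = (\<Sum>b\<in>B. c b * \<sigma> b)"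
        using c(2) B assms(1) Gal_fix[OF that] by (intro sum.cong refl) (metis hom_mult subsetD)
      finally show ?thesis .
    qed
    then have "\<sigma> z * y \<sigma> = (\<Sum>b\<in>B. c b * (\<sigma> b * y \<sigma>))" if "\<sigma> \<in> Gal F" for \<sigma>
      unfolding mult.assoc[symmetric] sum_distrib_right[symmetric] using that by metis
    then have "(\<Sum>\<sigma>\<in>Gal F. \<sigma> z * y \<sigma>) = (\<Sum>\<sigma>\<in>Gal F. \<Sum>b\<in>B. c b * (\<sigma> b * y \<sigma>))"
      by (rule sum.cong[OF refl])
    also have "\<dots> = (\<Sum>b\<in>B. c b * (\<Sum>\<sigma>\<in>Gal F. \<sigma> b * y \<sigma>))"
      by (subst sum.swap) (simp add: sum_distrib_left)
    finally show ?thesis using sol by simp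
  qed
  obtain \<alpha> where \<alpha>: "\<alpha> \<in> E" "inj_on (\<lambda>\<sigma>. \<sigma> \<alpha>) (Gal F)" by (rule primitive_element)
  \<comment> \<open>The coefficients of \<open>q\<close> are arbitrary complex numbers, so
    \<open>rel\<close> is applied to the powers of \<open>\<alpha>\<close> rather than to a value of
    \<open>q\<close>; weighting these relations by the coefficients of \<open>q\<close> isolates
    \<open>y \<sigma>0\<close>.\<close>
  obtain q where q: "\<forall>a\<in>(\<lambda>\<sigma>. \<sigma> \<alpha>) ` Gal F. poly q a = (if a = \<sigma>0 \<alpha> then 1 else 0)"
    using interpolation_poly_exists[of "(\<lambda>\<sigma>. \<sigma> \<alpha>) ` Gal F" "\<lambda>a. if a = \<sigma>0 \<alpha> then 1 else 0"] finite_Gal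
    by blast
  have "(\<Sum>\<sigma>\<in>Gal F. poly q (\<sigma> \<alpha>) * y \<sigma>) = (\<Sum>\<sigma>\<in>Gal F. if \<sigma> = \<sigma>0 then y \<sigma> else 0)"
    using q y(1) inj_onD[OF \<alpha>(2) _ _ y(1)] by (intro sum.cong refl) auto
  also have "\<dots> = y \<sigma>0" using y(1) finite_Gal by simp
  finally have "y \<sigma>0 = (\<Sum>\<sigma>\<in>Gal F. poly q (\<sigma> \<alpha>) * y \<sigma>)" ..
  also have "\<dots> = (\<Sum>\<sigma>\<in>Gal F. \<Sum>i\<le>degree q. coeff q i * (\<sigma> \<alpha> ^ i * y \<sigma>))"
    by (simp add: poly_altdef sum_distrib_right mult.assoc)
  also have "\<dots> = (\<Sum>i\<le>degree q. coeff q i * (\<Sum>\<sigma>\<in>Gal F. \<sigma> \<alpha> ^ i * y \<sigma>))"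
    by (subst sum.swap) (simp add: sum_distrib_left)
  also have "\<dots> = (\<Sum>i\<le>degree q. coeff q i * (\<Sum>\<sigma>\<in>Gal F. \<sigma> (\<alpha> ^ i) * y \<sigma>))"
    using subfield_hom.hom_power[OF Gal_field_hom \<alpha>(1)] by (intro sum.cong refl arg_cong2[of _ _ _ _ "(*)"]) simp
  also have "\<dots> = 0" using rel[OF power_mem[OF \<alpha>(1)]] by simp
  finally show False using y(2) by simp
qed

text \<open>The powers of a primitive element \<open>\<alpha>\<close> span: \<open>z = p(\<alpha>)\<close> for the polynomial \<open>p\<close> interpolating
  \<open>\<sigma> \<alpha> \<mapsto> \<sigma> z\<close>. A homomorphism over \<open>F\<close> permutes the interpolation conditions, so by uniqueness it fixes
  the coefficients of \<open>p\<close>, which therefore lie in \<open>F\<close>.\<close>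

lemma exists_basis:
  assumes F: "is_subfield F" "F \<subseteq> E"
  shows "\<exists>B. is_basis_over F E B \<and> card B = card (Gal F)"
proof -
  interpret F: complex_subfield F by unfold_locales (rule F)
  obtain \<alpha> where \<alpha>: "\<alpha> \<in> E" "inj_on (\<lambda>\<sigma>. \<sigma> \<alpha>) (Gal F)" by (rule primitive_element)
  define n where "n = card (Gal F)"
  define R where "R = (\<lambda>\<sigma>. \<sigma> \<alpha>) ` Gal F"
  have R: "finite R" "card R = n" "\<alpha> \<in> R"
    using finite_Gal card_image[OF \<alpha>(2)] id_Gal[of F] by (auto simp: R_def n_def intro: image_eqI[of _ _ id])
  \<comment> \<open>A polynomial over \<open>F\<close> with root \<open>\<alpha>\<close> has all
    \<open>n\<close> conjugates of \<open>\<alpha>\<close> as roots.\<close>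
  have indep: "p = 0" if "p \<in> poly_over F" "\<And>i. i \<ge> n \<Longrightarrow> coeff p i = 0" "poly p \<alpha> = 0" for p
  proof (rule poly_eq_0_if_many_roots[OF R(1)])
    fix a assume "a \<in> R"
    then obtain \<sigma> where s: "\<sigma> \<in> Gal F" "a = \<sigma> \<alpha>" by (auto simp: R_def)
    interpret subfield_hom E \<sigma> using s(1) by (rule Gal_field_hom)
    show "poly p a = 0" using Gal_map_poly[OF s(1) that(1) F(2) \<alpha>(1)] s that(3) by simp
  qed (use that R in auto)
  have inj: "inj_on (\<lambda>i. \<alpha> ^ i) {..<n}"
  proof (rule inj_onI, rule ccontr)
    fix i j assume ij: "i \<in> {..<n}" "j \<in> {..<n}" "\<alpha> ^ i = \<alpha> ^ j" "i \<noteq> j"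
    have "monom 1 i - monom 1 j = (0 :: complex poly)"
      using ij by (intro indep F.poly_over_diff F.poly_over_monom) (auto simp: poly_monom)
    then have "coeff (monom 1 i - monom 1 j :: complex poly) i = 0" by simp
    then show False using ij by simp
  qed
  define B where "B = (\<lambda>i. \<alpha> ^ i) ` {..<n}"
  have sum_B: "(\<Sum>b\<in>B. c b * b) = (\<Sum>i<n. c (\<alpha> ^ i) * \<alpha> ^ i)" for c
    unfolding B_def by (subst sum.reindex[OF inj]) simp
  define P where "P d = (\<Sum>i<n. monom (d i) i)" for d :: "nat \<Rightarrow> complex"
  have coeff_P: "coeff (P d) i = (if i < n then d i else 0)" for d i
    by (simp add: P_def coeff_sum)
  have poly_P: "poly (P d) x = (\<Sum>i<n. d i * x ^ i)" for d x
    by (simp add: P_def poly_sum poly_monom)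
  have "\<forall>b\<in>B. c b = 0" if c: "\<forall>b\<in>B. c b \<in> F" "(\<Sum>b\<in>B. c b * b) = 0" for c
  proof -
    have "P (\<lambda>i. c (\<alpha> ^ i)) = 0"
      using c by (intro indep) (auto simp: poly_over_def coeff_P poly_P sum_B[symmetric] B_def)
    then have "c (\<alpha> ^ i) = 0" if "i < n" for i
      using coeff_P[of "\<lambda>i. c (\<alpha> ^ i)" i] that by simp
    then show ?thesis by (auto simp: B_def)
  qed
  moreover have "\<exists>c. (\<forall>b\<in>B. c b \<in> F) \<and> z = (\<Sum>b\<in>B. c b * b)" if z: "z \<in> E" for z
  proof -
    \<comment> \<open>The description is unique because \<open>\<sigma> \<alpha>\<close> determines
      \<open>\<sigma>\<close>.\<close>
    define f where "f a = (THE w. \<exists>\<sigma>\<in>Gal F. a = \<sigma> \<alpha> \<and> w = \<sigma> z)" for a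
    have f: "f (\<sigma> \<alpha>) = \<sigma> z" if "\<sigma> \<in> Gal F" for \<sigma>
      unfolding f_def using that \<alpha>(2) by (intro the_equality) (auto dest: inj_onD)
    obtain p where p: "\<forall>i\<ge>n. coeff p i = 0" "\<forall>a\<in>R. poly p a = f a"
      using interpolation_poly_exists[OF R(1), of f] R(2) by blast
    have pF: "coeff p i \<in> F" for i
    proof (rule ccontr)
      assume i: "coeff p i \<notin> F"
      have "coeff p j \<in> insert 0 (coeff p ` {..<n})" for j
        using p(1) by (cases "j < n") auto
      then have "range (coeff p) \<subseteq> insert 0 (coeff p ` {..<n})" by blast
      then have "finite (range (coeff p))" by (rule finite_subset) simp
      then obtain L \<phi> where L: "is_subfield L" "E \<subseteq> L" "range (coeff p) \<subseteq> L" "field_hom_on L \<phi>"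
        "\<And>k. k \<in> F \<Longrightarrow> \<phi> k = k" "\<phi> (coeff p i) \<noteq> coeff p i"
        by (rule exists_moving_hom[OF F i]) blast
      interpret L: subfield_hom L \<phi> by unfold_locales (rule L)+
      define \<tau> where "\<tau> = (\<lambda>z. if z \<in> E then \<phi> z else z)"
      have \<tau>: "\<tau> \<in> Gal F" unfolding \<tau>_def by (rule restrict_Gal[OF L(4,2,5)])
      have pL: "p \<in> poly_over L" using L(3) by (auto simp: poly_over_def)
      have "map_poly \<phi> p - p = 0"
      proof (rule poly_eq_0_if_many_roots[OF R(1)])
        fix a assume "a \<in> R"
        then obtain \<sigma> where s: "\<sigma> \<in> Gal F" "a = \<sigma> \<alpha>" by (auto simp: R_def)
        \<comment> \<open>With this choice \<open>\<phi>\<close> carries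
          \<open>\<rho> \<alpha>\<close> to the node \<open>a\<close> and \<open>\<rho> z\<close> to
          \<open>\<sigma> z\<close>: applying \<open>\<phi>\<close> to the interpolation condition
          at one node gives the condition at another.\<close>
        define \<rho> where "\<rho> = inv_into UNIV \<tau> \<circ> \<sigma>"
        have r: "\<rho> \<in> Gal F" unfolding \<rho>_def using s \<tau> by (intro comp_Gal inv_Gal)
        have \<rho>E: "\<rho> x \<in> E" "\<phi> (\<rho> x) = \<sigma> x" if "x \<in> E" for x
        proof -
          show "\<rho> x \<in> E" using r that by (rule Gal_mem)
          then have "\<phi> (\<rho> x) = \<tau> (\<rho> x)" by (simp add: \<tau>_def)
          also have "\<dots> = \<sigma> x" using Gal_bij[OF \<tau>] by (simp add: \<rho>_def bij_is_surj surj_f_inv_f)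
          finally show "\<phi> (\<rho> x) = \<sigma> x" .
        qed
        have "poly (map_poly \<phi> p) (\<phi> (\<rho> \<alpha>)) = \<phi> (poly p (\<rho> \<alpha>))"
          using pL \<rho>E \<alpha>(1) L(2) by (intro L.poly_map_hom) auto
        also have "poly p (\<rho> \<alpha>) = \<rho> z" using p(2) r f by (auto simp: R_def)
        finally have "poly (map_poly \<phi> p) a = \<sigma> z" using \<rho>E z \<alpha>(1) s(2) by simp
        moreover have "poly p a = \<sigma> z" using p(2) s f by (auto simp: R_def)
        ultimately show "poly (map_poly \<phi> p - p) a = 0" by simp
      qed (use p(1) R(2) in simp)
      then have "coeff (map_poly \<phi> p - p) i = 0" by simp
      then show False using L(6) by simp
    qed
    have "p = P (coeff p)" using p(1) by (intro poly_eqI) (simp add: coeff_P)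
    then have "poly p \<alpha> = (\<Sum>i<n. coeff p i * \<alpha> ^ i)" by (metis poly_P)
    moreover have "poly p \<alpha> = z" using p(2) R(3) f[OF id_Gal] by simp
    \<comment> \<open>Coefficients in a basis expansion are indexed by basis elements, so the
      exponent has to be recovered from the power.\<close>
    moreover have "coeff p (the_inv_into {..<n} (\<lambda>i. \<alpha> ^ i) (\<alpha> ^ i)) = coeff p i" if "i < n" for i
      using inj that by (simp add: the_inv_into_f_f)
    ultimately show ?thesis
      by (intro exI[of _ "\<lambda>b. coeff p (the_inv_into {..<n} (\<lambda>i. \<alpha> ^ i) b)"]) (simp add: sum_B pF)
  qed
  moreover have "B \<subseteq> E" using \<alpha>(1) by (auto simp: B_def)
  moreover have "(\<Sum>b\<in>B. c b * b) \<in> E" if "\<forall>b\<in>B. c b \<in> F" for c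
    using that F(2) \<open>B \<subseteq> E\<close> by (intro sum_mem mult_mem) auto
  moreover have "finite B" "card B = n" using card_image[OF inj] by (simp_all add: B_def)
  ultimately have "is_basis_over F E B" unfolding is_basis_over_def by blast
  with \<open>card B = n\<close> show ?thesis unfolding n_def by blast
qed

text \<open>\<open>field_degree\<close> is a least cardinality, so one basis of this size and the
  lower bound for all bases determine it.\<close>

lemma field_degree_eq_card_Gal:
  assumes "is_subfield F" "F \<subseteq> E"
  shows "field_degree E F = card (Gal F)"
  unfolding field_degree_def
proof (rule Least_equality)
  show "\<exists>B. is_basis_over F E B \<and> card B = card (Gal F)" using assms by (rule exists_basis)
  show "card (Gal F) \<le> m" if "\<exists>B. is_basis_over F E B \<and> card B = m" for m
    using that card_basis_ge[OF assms(2)] by blast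
qed

end

section \<open>Schur relations\<close>

lemma mult_mat_index:
  assumes "A \<in> carrier_mat n m" "B \<in> carrier_mat m k" "i < n" "j < k"
  shows "(A * B) $$ (i, j) = (\<Sum>l<m. A $$ (i, l) * B $$ (l, j))"
  using assms by (simp add: scalar_prod_def lessThan_atLeast0)

lemma mult_mat_vec_index:
  assumes "A \<in> carrier_mat n m" "v \<in> carrier_vec m" "i < n"
  shows "(A *\<^sub>v v) $ i = (\<Sum>l<m. A $$ (i, l) * v $ l)"
  using assms by (simp add: scalar_prod_def lessThan_atLeast0)

lemma mat_trace_eq: "A \<in> carrier_mat n n \<Longrightarrow> mat_trace A = (\<Sum>i<n. A $$ (i, i))"
  unfolding mat_trace_def by simp

lemma mat_trace_comm:
  assumes "A \<in> carrier_mat n n" "B \<in> carrier_mat n n"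
  shows "mat_trace (A * B) = mat_trace (B * A)"
proof -
  have "mat_trace (A * B) = (\<Sum>i<n. \<Sum>l<n. A $$ (i, l) * B $$ (l, i))"
    using assms by (simp add: mat_trace_eq[of _ n] mult_mat_index[of _ n n _ n] del: index_mult_mat)
  also have "\<dots> = (\<Sum>l<n. \<Sum>i<n. B $$ (l, i) * A $$ (i, l))"
    by (subst sum.swap) (simp add: mult.commute)
  also have "\<dots> = mat_trace (B * A)"
    using assms by (simp add: mat_trace_eq[of _ n] mult_mat_index[of _ n n _ n] del: index_mult_mat)
  finally show ?thesis .
qed

lemma mat_trace_similar:
  assumes "P \<in> carrier_mat n n" "A \<in> carrier_mat n n" "Q \<in> carrier_mat n n" "Q * P = 1\<^sub>m n"
  shows "mat_trace (P * A * Q) = mat_trace A"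
proof -
  have "mat_trace (P * A * Q) = mat_trace (Q * (P * A))"
    using assms by (intro mat_trace_comm) auto
  also have "Q * (P * A) = A" using assms by (simp flip: assoc_mult_mat[of Q n n P n A n])
  finally show ?thesis .
qed

text \<open>The group average of the matrix unit with its one in row \<open>j\<close>, column \<open>k\<close>.\<close>

definition averaged_unit ::
  "('g, 'b) monoid_scheme \<Rightarrow> nat \<Rightarrow> ('g \<Rightarrow> complex mat) \<Rightarrow> ('g \<Rightarrow> complex mat) \<Rightarrow> nat \<Rightarrow> nat \<Rightarrow> complex mat" where
  "averaged_unit G d \<rho> \<tau> j k =
    mat d d (\<lambda>(i, l). \<Sum>g\<in>carrier G. \<tau> (inv\<^bsub>G\<^esub> g) $$ (i, j) * \<rho> g $$ (k, l))"

section \<open>Schur's lemma, orthogonality relations and the converse criterion for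
  irreducibility\<close>

context
  fixes G :: "('g, 'b) monoid_scheme" (structure)
  assumes group: "group G" and fin: "finite (carrier G)"
begin

interpretation group G by (rule group)

lemma sum_translate:
  assumes "h \<in> carrier G"
  shows "(\<Sum>g\<in>carrier G. f (g \<otimes> h)) = (\<Sum>g\<in>carrier G. f g)"
  by (rule sum.reindex_bij_witness[of _ "\<lambda>g. g \<otimes> inv h" "\<lambda>g. g \<otimes> h"]) (use assms in \<open>auto simp: m_assoc\<close>)

text \<open>The kernel of \<open>T\<close> is an invariant subspace; as it contains
  \<open>v\<close>, it is everything. The kernel vector is a hypothesis so that the lemma serves
  both a singular intertwiner of two representations and an intertwiner shifted by an
  eigenvalue.\<close>

lemma intertwiner_eq_0:
  assumes irr: "irreducible_rep G d \<rho>" and T: "T \<in> carrier_mat d d"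
    and \<tau>: "\<And>g. g \<in> carrier G \<Longrightarrow> \<tau> g \<in> carrier_mat d d"
    and comm: "\<And>g. g \<in> carrier G \<Longrightarrow> T * \<rho> g = \<tau> g * T"
    and v: "v \<in> carrier_vec d" "v \<noteq> 0\<^sub>v d" "T *\<^sub>v v = 0\<^sub>v d"
  shows "T = 0\<^sub>m d d"
proof -
  have \<rho>: "\<rho> g \<in> carrier_mat d d" if "g \<in> carrier G" for g
    using irr that unfolding irreducible_rep_def is_rep_def by blast
  define W where "W = {v \<in> carrier_vec d. T *\<^sub>v v = 0\<^sub>v d}"
  have "T *\<^sub>v (\<rho> g *\<^sub>v w) = 0\<^sub>v d" if "g \<in> carrier G" "w \<in> W" for g w
  proof -
    have w: "w \<in> carrier_vec d" "T *\<^sub>v w = 0\<^sub>v d" using that by (auto simp: W_def)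
    have "T *\<^sub>v (\<rho> g *\<^sub>v w) = \<tau> g * T *\<^sub>v w"
      using assoc_mult_mat_vec[OF T \<rho>[OF that(1)] w(1)] comm[OF that(1)] by simp
    also have "\<dots> = \<tau> g *\<^sub>v (T *\<^sub>v w)" by (rule assoc_mult_mat_vec[OF \<tau>[OF that(1)] T w(1)])
    also have "\<dots> = 0\<^sub>v d"
      using \<tau>[OF that(1)] unfolding w(2) by (intro eq_vecI) (auto simp: scalar_prod_def)
    finally show ?thesis .
  qed
  then have "rep_invariant_subspace G d \<rho> W"
    unfolding rep_invariant_subspace_def using T \<rho>
    by (auto simp: W_def mult_add_distrib_mat_vec[OF T] mult_mat_vec[OF T] intro: mult_mat_vec_carrier[OF \<rho>])
  moreover have "W \<noteq> {0\<^sub>v d}" using v by (auto simp: W_def)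
  ultimately have W: "W = carrier_vec d" using irr unfolding irreducible_rep_def by blast
  show ?thesis
  proof (rule eq_matI)
    fix i j assume ij: "i < dim_row (0\<^sub>m d d :: complex mat)" "j < dim_col (0\<^sub>m d d :: complex mat)"
    have "unit_vec d j \<in> W" unfolding W by simp
    then have "T *\<^sub>v unit_vec d j = 0\<^sub>v d" by (simp add: W_def)
    then have "(\<Sum>l<d. T $$ (i, l) * unit_vec d j $ l) = 0"
      using mult_mat_vec_index[OF T, of "unit_vec d j" i] ij by simp
    also have "(\<Sum>l<d. T $$ (i, l) * unit_vec d j $ l) = (\<Sum>l<d. if l = j then T $$ (i, l) else 0)"
      using ij by (intro sum.cong) auto
    finally show "T $$ (i, j) = 0\<^sub>m d d $$ (i, j)" using ij by simp
  qed (use T in auto)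
qed

context
  fixes d :: nat and \<rho> \<tau> :: "'g \<Rightarrow> complex mat"
  assumes rho: "is_rep G d \<rho>" and tau: "is_rep G d \<tau>"
begin

lemma averaged_unit_carrier: "averaged_unit G d \<rho> \<tau> j k \<in> carrier_mat d d"
  unfolding averaged_unit_def by simp

lemma averaged_unit_intertwines:
  assumes "j < d" "k < d" and h: "h \<in> carrier G"
  shows "averaged_unit G d \<rho> \<tau> j k * \<rho> h = \<tau> h * averaged_unit G d \<rho> \<tau> j k"
proof (rule eq_matI)
  have \<rho>: "\<rho> g \<in> carrier_mat d d" "\<tau> g \<in> carrier_mat d d" if "g \<in> carrier G" for g
    using rho tau that unfolding is_rep_def by auto
  have mult: "\<rho> (x \<otimes> y) = \<rho> x * \<rho> y" "\<tau> (x \<otimes> y) = \<tau> x * \<tau> y" if "x \<in> carrier G" "y \<in> carrier G" for x y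
    using rho tau that unfolding is_rep_def by auto
  fix i l assume "i < dim_row (\<tau> h * averaged_unit G d \<rho> \<tau> j k)" "l < dim_col (\<tau> h * averaged_unit G d \<rho> \<tau> j k)"
  then have il: "i < d" "l < d" using \<rho>[OF h] by (auto simp: averaged_unit_def)
  have "(averaged_unit G d \<rho> \<tau> j k * \<rho> h) $$ (i, l) = (\<Sum>m<d. \<Sum>g\<in>carrier G. \<tau> (inv g) $$ (i, j) * (\<rho> g $$ (k, m) * \<rho> h $$ (m, l)))"
    unfolding mult_mat_index[OF averaged_unit_carrier \<rho>(1)[OF h] il]
    using il by (simp add: averaged_unit_def sum_distrib_right mult.assoc)
  also have "\<dots> = (\<Sum>g\<in>carrier G. \<tau> (inv g) $$ (i, j) * \<rho> (g \<otimes> h) $$ (k, l))"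
    by (subst sum.swap, rule sum.cong)
      (simp_all add: mult h mult_mat_index[OF \<rho>(1) \<rho>(1)] assms il sum_distrib_left del: index_mult_mat)
  \<comment> \<open>Writing \<open>inv g\<close> as \<open>h \<otimes> inv (g \<otimes> h)\<close>
    makes the summand a function of \<open>g \<otimes> h\<close>, ready for translation.\<close>
  also have "\<dots> = (\<Sum>g\<in>carrier G. \<tau> (h \<otimes> inv (g \<otimes> h)) $$ (i, j) * \<rho> (g \<otimes> h) $$ (k, l))"
    using h by (intro sum.cong) (simp_all add: inv_mult_group flip: m_assoc)
  also have "\<dots> = (\<Sum>g\<in>carrier G. \<tau> (h \<otimes> inv g) $$ (i, j) * \<rho> g $$ (k, l))"
    by (rule sum_translate[OF h])
  also have "\<dots> = (\<Sum>m<d. \<Sum>g\<in>carrier G. \<tau> h $$ (i, m) * (\<tau> (inv g) $$ (m, j) * \<rho> g $$ (k, l)))"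
    by (subst sum.swap, rule sum.cong)
      (simp_all add: mult h mult_mat_index[OF \<rho>(2) \<rho>(2)] assms il sum_distrib_right mult.assoc del: index_mult_mat)
  also have "\<dots> = (\<tau> h * averaged_unit G d \<rho> \<tau> j k) $$ (i, l)"
    unfolding mult_mat_index[OF \<rho>(2)[OF h] averaged_unit_carrier il]
    using il by (simp add: averaged_unit_def sum_distrib_left)
  finally show "(averaged_unit G d \<rho> \<tau> j k * \<rho> h) $$ (i, l) = (\<tau> h * averaged_unit G d \<rho> \<tau> j k) $$ (i, l)" .
qed (use rho tau h in \<open>auto simp: is_rep_def averaged_unit_def\<close>)

end

text \<open>If the averaged matrix \<open>T\<close> were invertible, it would conjugate
  \<open>\<rho> h\<close> into \<open>\<tau> h\<close> and the traces would agree. So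
  \<open>T\<close> has a kernel vector and vanishes, which is the claim read entrywise.\<close>

lemma schur_orthogonality_distinct:
  assumes irr: "irreducible_rep G d \<rho>" and tau: "is_rep G d \<tau>"
    and ne: "h \<in> carrier G" "mat_trace (\<rho> h) \<noteq> mat_trace (\<tau> h)"
    and ijkl: "i < d" "j < d" "k < d" "l < d"
  shows "(\<Sum>g\<in>carrier G. \<tau> (inv g) $$ (i, j) * \<rho> g $$ (k, l)) = 0"
proof -
  have rho: "is_rep G d \<rho>" using irr unfolding irreducible_rep_def by blast
  have \<rho>: "\<rho> g \<in> carrier_mat d d" "\<tau> g \<in> carrier_mat d d" if "g \<in> carrier G" for g
    using rho tau that unfolding is_rep_def by auto
  define T where "T = averaged_unit G d \<rho> \<tau> j k"
  have T: "T \<in> carrier_mat d d" unfolding T_def by (rule averaged_unit_carrier[OF rho tau])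
  have comm: "T * \<rho> g = \<tau> g * T" if "g \<in> carrier G" for g
    unfolding T_def using averaged_unit_intertwines[OF rho tau ijkl(2,3) that] .
  have "det T = 0"
  proof (rule ccontr)
    assume "det T \<noteq> 0"
    from det_non_zero_imp_unit[OF T this, unfolded Units_def, of "()"]
    obtain B where B: "B \<in> carrier_mat d d" "B * T = 1\<^sub>m d" "T * B = 1\<^sub>m d"
      by (auto simp: ring_mat_def)
    have "\<tau> h = \<tau> h * (T * B)" using B \<rho>[OF ne(1)] by simp
    also have "\<dots> = T * \<rho> h * B"
      using comm[OF ne(1)] assoc_mult_mat[OF \<rho>(2)[OF ne(1)] T B(1)] by simp
    finally show False using mat_trace_similar[OF T \<rho>(1)[OF ne(1)] B(1,2)] ne(2) by simp
  qed
  then obtain v where "v \<in> carrier_vec d" "v \<noteq> 0\<^sub>v d" "T *\<^sub>v v = 0\<^sub>v d"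
    using det_0_iff_vec_prod_zero[OF T] by blast
  then have "T = 0\<^sub>m d d" using intertwiner_eq_0[OF irr T \<rho>(2) comm] by blast
  then have "T $$ (i, l) = 0" using ijkl by simp
  then show ?thesis using ijkl by (simp add: T_def averaged_unit_def)
qed

text \<open>Subtracting an eigenvalue \<open>c\<close> from the averaged matrix \<open>T\<close>
  leaves a singular intertwiner, so \<open>T\<close> is scalar. The trace determines
  \<open>c\<close>: the sum over the diagonal turns into entries of
  \<open>\<rho> (g \<otimes> inv g)\<close>, the identity matrix, whence \<open>d * c\<close> is the
  group order if \<open>j = k\<close> and 0 otherwise.\<close>

lemma schur_orthogonality:
  assumes irr: "irreducible_rep G d \<rho>" and ijkl: "i < d" "j < d" "k < d" "l < d"
  shows "(\<Sum>g\<in>carrier G. \<rho> (inv g) $$ (i, j) * \<rho> g $$ (k, l)) =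
    (if i = l \<and> j = k then of_nat (Coset.order G) / of_nat d else 0)"
proof -
  have rho: "is_rep G d \<rho>" using irr unfolding irreducible_rep_def by blast
  have \<rho>: "\<rho> g \<in> carrier_mat d d" if "g \<in> carrier G" for g
    using rho that unfolding is_rep_def by auto
  define T where "T = averaged_unit G d \<rho> \<rho> j k"
  have T: "T \<in> carrier_mat d d" unfolding T_def by (rule averaged_unit_carrier[OF rho rho])
  have T_index: "T $$ (a, b) = (\<Sum>g\<in>carrier G. \<rho> (inv g) $$ (a, j) * \<rho> g $$ (k, b))" if "a < d" "b < d" for a b
    using that by (simp add: T_def averaged_unit_def)
  have comm: "T * \<rho> g = \<rho> g * T" if "g \<in> carrier G" for g
    unfolding T_def using averaged_unit_intertwines[OF rho rho ijkl(2,3) that] .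
  have "degree (char_poly T) \<noteq> 0" using degree_monic_char_poly[OF T] ijkl by simp
  then obtain c where "poly (char_poly T) c = 0"
    using fundamental_theorem_of_algebra[of "char_poly T"] by (auto simp: constant_degree)
  then have det0: "det (char_matrix T c) = 0" using eigenvalue_root_char_poly[OF T] eigenvalue_det[OF T] by simp
  define U where "U = char_matrix T c"
  have U: "U \<in> carrier_mat d d" using T by (simp add: U_def)
  have U_eq: "U = T - c \<cdot>\<^sub>m 1\<^sub>m d" using T unfolding U_def char_matrix_def by (intro eq_matI) auto
  have "det U = 0" using det0 by (simp only: U_def)
  then obtain v where v: "v \<in> carrier_vec d" "v \<noteq> 0\<^sub>v d" "U *\<^sub>v v = 0\<^sub>v d"
    using det_0_iff_vec_prod_zero[OF U] by blast
  have commU: "U * \<rho> g = \<rho> g * U" if "g \<in> carrier G" for g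
  proof -
    have c1: "c \<cdot>\<^sub>m 1\<^sub>m d \<in> carrier_mat d d" by simp
    have "U * \<rho> g = T * \<rho> g - c \<cdot>\<^sub>m \<rho> g"
      unfolding U_eq minus_mult_distrib_mat[OF T c1 \<rho>[OF that]]
      using \<rho>[OF that] mult_smult_assoc_mat[OF one_carrier_mat \<rho>[OF that]] by simp
    moreover have "\<rho> g * U = \<rho> g * T - c \<cdot>\<^sub>m \<rho> g"
      unfolding U_eq mult_minus_distrib_mat[OF \<rho>[OF that] T c1]
      using \<rho>[OF that] mult_smult_distrib[OF \<rho>[OF that] one_carrier_mat] by simp
    ultimately show ?thesis using comm[OF that] by simp
  qed
  have "U = 0\<^sub>m d d" by (rule intertwiner_eq_0[OF irr U \<rho> commU v])
  have T_scalar: "T $$ (a, b) = (if a = b then c else 0)" if "a < d" "b < d" for a b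
  proof -
    have "U $$ (a, b) = 0" using \<open>U = 0\<^sub>m d d\<close> that by simp
    then show ?thesis using that T unfolding U_eq by auto
  qed
  have "of_nat d * c = (\<Sum>a<d. T $$ (a, a))" by (simp add: T_scalar)
  also have "\<dots> = (\<Sum>g\<in>carrier G. \<Sum>a<d. \<rho> g $$ (k, a) * \<rho> (inv g) $$ (a, j))"
    by (subst sum.swap) (simp add: T_index mult.commute)
  also have "\<dots> = (\<Sum>g\<in>carrier G. \<rho> (g \<otimes> inv g) $$ (k, j))"
  proof (rule sum.cong)
    fix g assume g: "g \<in> carrier G"
    have "\<rho> (g \<otimes> inv g) = \<rho> g * \<rho> (inv g)" using rho g unfolding is_rep_def by blast
    then show "(\<Sum>a<d. \<rho> g $$ (k, a) * \<rho> (inv g) $$ (a, j)) = \<rho> (g \<otimes> inv g) $$ (k, j)"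
      using mult_mat_index[OF \<rho>[OF g] \<rho>[OF inv_closed[OF g]] ijkl(3,2)] by simp
  qed simp
  also have "\<dots> = (if j = k then of_nat (Coset.order G) else 0)"
    using rho ijkl by (simp add: is_rep_def Coset.order_def)
  finally have "c = (if j = k then of_nat (Coset.order G) / of_nat d else 0)"
    using ijkl by (auto simp: field_simps)
  then show ?thesis using ijkl unfolding T_index[OF ijkl(1,4), symmetric] T_scalar[OF ijkl(1,4)] by auto
qed

text \<open>After triangularization, powers act on each diagonal entry separately, and
  \<open>\<rho> g\<close> raised to the group order is the identity. One family \<open>lam\<close>
  has to serve all powers, since \<open>hom_char_value\<close> compares \<open>\<chi> g\<close> with
  \<open>\<chi>\<close> at a power of \<open>g\<close>.\<close>

lemma rep_trace_eigenvalues: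
  assumes rho: "is_rep G d \<rho>" and g: "g \<in> carrier G"
  obtains lam where "\<And>i. i < d \<Longrightarrow> lam i ^ Coset.order G = 1"
    "\<And>k. mat_trace (\<rho> (g [^] (k :: nat))) = (\<Sum>i<d. lam i ^ k)"
proof -
  define A where "A = \<rho> g"
  have A: "A \<in> carrier_mat d d" using rho g unfolding is_rep_def A_def by blast
  have pow: "\<rho> (g [^] k) = A ^\<^sub>m k" for k :: nat
    using rho g A by (induction k) (auto simp: is_rep_def A_def)
  obtain es where "char_poly A = (\<Prod>a\<leftarrow>es. [:- a, 1:])" using char_poly_factorized[OF A] by blast
  then obtain B where B: "B \<in> carrier_mat d d" "upper_triangular B" "similar_mat A B"
    using schur_decomposition_exists[OF A] by blast
  then obtain P Q where wit: "similar_mat_wit A B P Q" unfolding similar_mat_def by blast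
  note PQ = similar_mat_witD2[OF A wit]
  have Bk: "B ^\<^sub>m k \<in> carrier_mat d d" for k using B(1) by simp
  have tri: "(\<forall>i<d. \<forall>j<i. (B ^\<^sub>m k) $$ (i, j) = 0) \<and> (\<forall>i<d. (B ^\<^sub>m k) $$ (i, i) = (B $$ (i, i)) ^ k)" for k
  proof (induction k)
    case 0
    show ?case using B(1) by auto
  next
    case (Suc k)
    have up: "B $$ (i, j) = 0" if "i < d" "j < i" for i j
      using B(1,2) that unfolding upper_triangular_def by auto
    have entry: "(B ^\<^sub>m k) $$ (i, l) * B $$ (l, j) = (if l = i \<and> i = j then (B $$ (i, i)) ^ k * B $$ (i, i) else 0)"
      if "i < d" "j \<le> i" "l < d" for i j l
    proof (cases "l < i")
      case False
      then show ?thesis using that Suc up[of l j] by (cases "l = j") auto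
    qed (use Suc that in auto)
    have "(B ^\<^sub>m Suc k) $$ (i, j) = (\<Sum>l<d. if l = i then (if i = j then (B $$ (i, i)) ^ Suc k else 0) else 0)"
      if "i < d" "j \<le> i" for i j
      using that entry unfolding pow_mat.simps
      by (subst mult_mat_index[OF Bk B(1)]) (auto intro!: sum.cong simp: mult.commute)
    then show ?case by auto
  qed
  have trace: "mat_trace (\<rho> (g [^] k)) = (\<Sum>i<d. (B $$ (i, i)) ^ k)" for k :: nat
  proof -
    have "A ^\<^sub>m k = P * B ^\<^sub>m k * Q" using similar_mat_wit_pow_id[OF wit] .
    then have "mat_trace (A ^\<^sub>m k) = mat_trace (B ^\<^sub>m k)"
      using mat_trace_similar[OF PQ(6) Bk PQ(7,2)] by simp
    then show ?thesis using tri by (simp add: pow mat_trace_eq[OF Bk])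
  qed
  have "(B $$ (i, i)) ^ Coset.order G = 1" if "i < d" for i
  proof -
    have "A ^\<^sub>m Coset.order G = 1\<^sub>m d"
      using rho pow[of "Coset.order G"] pow_order_eq_1[OF g] by (simp add: is_rep_def)
    moreover have "B ^\<^sub>m Coset.order G = Q * A ^\<^sub>m Coset.order G * P"
      using similar_mat_wit_pow_id[OF similar_mat_wit_sym[OF wit]] .
    ultimately have "B ^\<^sub>m Coset.order G = 1\<^sub>m d" using PQ by simp
    moreover have "(B ^\<^sub>m Coset.order G) $$ (i, i) = (B $$ (i, i)) ^ Coset.order G" using tri that by blast
    ultimately show ?thesis using that by simp
  qed
  then show ?thesis using trace by (rule that[of "\<lambda>i. B $$ (i, i)"])
qed

text \<open>If \<open>v\<close> in \<open>W\<close> has a nonzero coordinate \<open>p\<close>,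
  weighting the vectors \<open>\<rho> g *\<^sub>v v\<close> by the entry \<open>(p, q)\<close> of
  \<open>R (inv g)\<close> and summing yields \<open>\<kappa> * v $ p\<close> times the unit vector
  \<open>q\<close>, so \<open>W\<close> is the whole space. The index set is arbitrary and
  enumerated by \<open>e\<close> because tensor products are indexed by functions.\<close>

lemma irreducible_rep_if_schur_relations:
  assumes e: "bij_betw e {..<D} I" and "0 < D" "\<kappa> \<noteq> 0"
    and one: "\<And>i j. i \<in> I \<Longrightarrow> j \<in> I \<Longrightarrow> R \<one> i j = (if i = j then 1 else 0)"
    and mult: "\<And>g h i j. g \<in> carrier G \<Longrightarrow> h \<in> carrier G \<Longrightarrow> i \<in> I \<Longrightarrow> j \<in> I \<Longrightarrow>
      R (g \<otimes> h) i j = (\<Sum>k\<in>I. R g i k * R h k j)"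
    and schur: "\<And>i j k l. i \<in> I \<Longrightarrow> j \<in> I \<Longrightarrow> k \<in> I \<Longrightarrow> l \<in> I \<Longrightarrow>
      (\<Sum>g\<in>carrier G. R (inv g) i j * R g k l) = (if i = l \<and> j = k then \<kappa> else (0 :: complex))"
  shows "irreducible_rep G D (\<lambda>g. mat D D (\<lambda>(i, j). R g (e i) (e j)))"
proof -
  define \<rho> where "\<rho> = (\<lambda>g. mat D D (\<lambda>(i, j). R g (e i) (e j)))"
  have eI: "e i \<in> I" if "i < D" for i using e that by (auto simp: bij_betw_def)
  have e_eq: "e i = e j \<longleftrightarrow> i = j" if "i < D" "j < D" for i j
    using e that by (auto simp: bij_betw_def inj_on_def)
  have \<rho>: "\<rho> g \<in> carrier_mat D D" for g by (simp add: \<rho>_def)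
  have \<rho>_index: "\<rho> g $$ (i, j) = R g (e i) (e j)" if "i < D" "j < D" for g i j
    using that by (simp add: \<rho>_def)
  have "is_rep G D \<rho>"
    unfolding is_rep_def
  proof (intro conjI ballI \<rho>)
    show "\<rho> \<one> = 1\<^sub>m D" by (rule eq_matI) (auto simp: \<rho>_def one eI e_eq)
    fix g h assume gh: "g \<in> carrier G" "h \<in> carrier G"
    show "\<rho> (g \<otimes> h) = \<rho> g * \<rho> h"
    proof (rule eq_matI)
      fix i j assume "i < dim_row (\<rho> g * \<rho> h)" "j < dim_col (\<rho> g * \<rho> h)"
      then have ij: "i < D" "j < D" by (simp_all add: \<rho>_def)
      have "(\<rho> g * \<rho> h) $$ (i, j) = (\<Sum>l<D. R g (e i) (e l) * R h (e l) (e j))"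
        unfolding mult_mat_index[OF \<rho> \<rho> ij] using ij by (simp add: \<rho>_index)
      also have "\<dots> = (\<Sum>k\<in>I. R g (e i) k * R h k (e j))"
        by (rule sum.reindex_bij_betw[OF e])
      finally show "\<rho> (g \<otimes> h) $$ (i, j) = (\<rho> g * \<rho> h) $$ (i, j)"
        using mult[OF gh eI[OF ij(1)] eI[OF ij(2)]] \<rho>_index[OF ij] by simp
    qed (simp_all add: \<rho>_def)
  qed
  moreover have "W = {0\<^sub>v D} \<or> W = carrier_vec D" if W: "rep_invariant_subspace G D \<rho> W" for W
  proof (rule disjCI)
    assume "W \<noteq> carrier_vec D"
    have Wsub: "W \<subseteq> carrier_vec D" and W0: "0\<^sub>v D \<in> W"
      and Wadd: "\<And>v w. v \<in> W \<Longrightarrow> w \<in> W \<Longrightarrow> v + w \<in> W"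
      and Wsmult: "\<And>c v. v \<in> W \<Longrightarrow> c \<cdot>\<^sub>v v \<in> W"
      and Winv: "\<And>g v. g \<in> carrier G \<Longrightarrow> v \<in> W \<Longrightarrow> \<rho> g *\<^sub>v v \<in> W"
      using W unfolding rep_invariant_subspace_def by auto
    have comb: "vec D (\<lambda>i. \<Sum>x\<in>X. c x * f x $ i) \<in> W" if "finite X" "\<And>x. x \<in> X \<Longrightarrow> f x \<in> W"
      for X :: "'x set" and c f
      using that
    proof (induction X)
      case empty
      have "vec D (\<lambda>i. 0 :: complex) = 0\<^sub>v D" by auto
      then show ?case using W0 by simp
    next
      case (insert x X)
      have fx: "f x \<in> W" using insert.prems by simp
      then have "f x \<in> carrier_vec D" using Wsub by blast
      then have dim: "dim_vec (f x) = D" by simp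
      have "vec D (\<lambda>i. \<Sum>x\<in>insert x X. c x * f x $ i) = c x \<cdot>\<^sub>v f x + vec D (\<lambda>i. \<Sum>x\<in>X. c x * f x $ i)"
        using insert.hyps dim by (intro eq_vecI) auto
      then show ?case using insert fx by (auto intro!: Wadd Wsmult)
    qed
    have unit: False if v: "v \<in> W" "v \<noteq> 0\<^sub>v D" for v
    proof -
      have vc: "v \<in> carrier_vec D" using v Wsub by blast
      then obtain p where p: "p < D" "v $ p \<noteq> 0" using v(2) by (metis carrier_vecD eq_vecI index_zero_vec)
      have unit: "unit_vec D q \<in> W" if q: "q < D" for q
      proof -
        define w where "w = vec D (\<lambda>i. \<Sum>g\<in>carrier G. R (inv g) (e p) (e q) * (\<rho> g *\<^sub>v v) $ i)"
        have "w \<in> W" unfolding w_def by (rule comb[OF fin]) (rule Winv[OF _ v(1)])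
        have "w $ i = \<kappa> * v $ p * unit_vec D q $ i" if i: "i < D" for i
        proof -
          have "w $ i = (\<Sum>g\<in>carrier G. \<Sum>m<D. R (inv g) (e p) (e q) * R g (e i) (e m) * v $ m)"
            using i by (simp add: w_def mult_mat_vec_index[OF \<rho> vc i] \<rho>_index sum_distrib_left mult.assoc del: index_mult_mat_vec)
          also have "\<dots> = (\<Sum>m<D. (\<Sum>g\<in>carrier G. R (inv g) (e p) (e q) * R g (e i) (e m)) * v $ m)"
            by (subst sum.swap) (simp add: sum_distrib_right)
          also have "\<dots> = (\<Sum>m<D. if m = p then (if q = i then \<kappa> * v $ m else 0) else 0)"
            using p q i by (intro sum.cong refl) (auto simp: schur eI e_eq)
          also have "\<dots> = \<kappa> * v $ p * unit_vec D q $ i" using p q i by auto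
          finally show ?thesis .
        qed
        moreover have "dim_vec w = D" by (simp add: w_def)
        ultimately have "unit_vec D q = (1 / (\<kappa> * v $ p)) \<cdot>\<^sub>v w"
          using p \<open>\<kappa> \<noteq> 0\<close> q by (intro eq_vecI) auto
        then show ?thesis using Wsmult[OF \<open>w \<in> W\<close>] by metis
      qed
      have "u \<in> W" if "u \<in> carrier_vec D" for u
      proof -
        have "u = vec D (\<lambda>i. \<Sum>q<D. u $ q * unit_vec D q $ i)"
        proof (rule eq_vecI)
          fix i assume "i < dim_vec (vec D (\<lambda>i. \<Sum>q<D. u $ q * unit_vec D q $ i))"
          then have i: "i < D" by simp
          have "(\<Sum>q<D. u $ q * unit_vec D q $ i) = (\<Sum>q<D. if q = i then u $ q else 0)"
            using i by (intro sum.cong) auto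
          then show "u $ i = vec D (\<lambda>i. \<Sum>q<D. u $ q * unit_vec D q $ i) $ i" using i by simp
        qed (use that in auto)
        then show ?thesis using comb[of "{..<D}" "unit_vec D" "\<lambda>q. u $ q"] unit by auto
      qed
      then show False using Wsub \<open>W \<noteq> carrier_vec D\<close> by blast
    qed
    then show "W = {0\<^sub>v D}" using W0 by blast
  qed
  ultimately show ?thesis using \<open>0 < D\<close> unfolding irreducible_rep_def \<rho>_def by blast
qed

text \<open>The wreath product consists of pairs of a function and an automorphism, while the
  theorem asks for a group of natural numbers. Finiteness gives an injection \<open>f\<close> along
  which multiplication and representation are transported.\<close>

lemma nat_group_with_same_character:
  assumes "irr_char G \<chi>"
  shows "\<exists>(H :: nat monoid) \<psi>. group H \<and> finite (carrier H) \<and> irr_char H \<psi> \<and>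
    char_field H \<psi> = char_field G \<chi> \<and> \<psi> \<one>\<^bsub>H\<^esub> = \<chi> \<one>"
proof -
  obtain f :: "'g \<Rightarrow> nat" where f: "inj_on f (carrier G)"
    using fin finite_imp_inj_to_nat_seg by blast
  define f' where "f' = the_inv_into (carrier G) f"
  have f'f: "f' (f x) = x" if "x \<in> carrier G" for x
    using f that by (simp add: f'_def the_inv_into_f_f)
  define H where "H = \<lparr>carrier = f ` carrier G, mult = \<lambda>x y. f (f' x \<otimes> f' y), one = f \<one>\<rparr>"
  have "group H"
  proof (rule groupI)
    fix x assume "x \<in> carrier H"
    then obtain g where g: "g \<in> carrier G" "x = f g" by (auto simp: H_def)
    then show "\<exists>y\<in>carrier H. y \<otimes>\<^bsub>H\<^esub> x = \<one>\<^bsub>H\<^esub>"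
      by (intro bexI[of _ "f (inv g)"]) (auto simp: H_def f'f)
  qed (auto simp: H_def f'f m_assoc)
  moreover have "finite (carrier H)" using fin by (simp add: H_def)
  moreover have "irr_char H (\<chi> \<circ> f')"
  proof -
    obtain d \<rho> where irr: "irreducible_rep G d \<rho>" and tr: "\<forall>g\<in>carrier G. \<chi> g = mat_trace (\<rho> g)"
      using assms unfolding irr_char_def by blast
    have "rep_invariant_subspace H d (\<rho> \<circ> f') W \<longleftrightarrow> rep_invariant_subspace G d \<rho> W" for W
      unfolding rep_invariant_subspace_def by (auto simp: H_def f'f)
    moreover have "is_rep H d (\<rho> \<circ> f')"
      using irr unfolding irreducible_rep_def is_rep_def by (auto simp: H_def f'f)
    ultimately have "irreducible_rep H d (\<rho> \<circ> f')"
      using irr unfolding irreducible_rep_def by simp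
    then show ?thesis unfolding irr_char_def using tr
      by (intro exI[of _ d] exI[of _ "\<rho> \<circ> f'"]) (auto simp: H_def f'f)
  qed
  moreover have "(\<chi> \<circ> f') ` carrier H = \<chi> ` carrier G"
    by (auto simp: H_def f'f image_image)
  moreover have "(\<chi> \<circ> f') \<one>\<^bsub>H\<^esub> = \<chi> \<one>" by (simp add: H_def f'f)
  ultimately show ?thesis unfolding char_field_def by metis
qed

end

section \<open>The wreath product representation\<close>

text \<open>An element \<open>s\<close> of the top group acts on the base group by \<open>(s h) t = h (t s)\<close>.\<close>

definition wreath :: "('g, 'b) monoid_scheme \<Rightarrow> ('a, 'c) monoid_scheme \<Rightarrow> (('a \<Rightarrow> 'g) \<times> 'a) monoid" where
  "wreath G A = \<lparr>carrier = (carrier A \<rightarrow>\<^sub>E carrier G) \<times> carrier A,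
     mult = \<lambda>(g, s) (h, u). (\<lambda>t\<in>carrier A. g t \<otimes>\<^bsub>G\<^esub> h (t \<otimes>\<^bsub>A\<^esub> s), s \<otimes>\<^bsub>A\<^esub> u),
     one = (\<lambda>t\<in>carrier A. \<one>\<^bsub>G\<^esub>, \<one>\<^bsub>A\<^esub>)\<rparr>"

section \<open>Group structure of the wreath product and its induced representation\<close>

context
  fixes G :: "('g, 'b) monoid_scheme" and A :: "('a, 'c) monoid_scheme"
  assumes grp_G: "group G" and fin_G: "finite (carrier G)" and grp_A: "group A" and fin_A: "finite (carrier A)"
begin

interpretation G: group G by (rule grp_G)
interpretation A: group A by (rule grp_A)

lemma wreath_simps:
  "carrier (wreath G A) = (carrier A \<rightarrow>\<^sub>E carrier G) \<times> carrier A"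
  "(g, s) \<otimes>\<^bsub>wreath G A\<^esub> (h, u) = (\<lambda>t\<in>carrier A. g t \<otimes>\<^bsub>G\<^esub> h (t \<otimes>\<^bsub>A\<^esub> s), s \<otimes>\<^bsub>A\<^esub> u)"
  "\<one>\<^bsub>wreath G A\<^esub> = (\<lambda>t\<in>carrier A. \<one>\<^bsub>G\<^esub>, \<one>\<^bsub>A\<^esub>)"
  by (simp_all add: wreath_def)

lemma finite_wreath: "finite (carrier (wreath G A))"
  using fin_G fin_A by (auto simp: wreath_simps intro!: finite_PiE)

lemma base_mem: "g \<in> carrier A \<rightarrow>\<^sub>E carrier G \<Longrightarrow> t \<in> carrier A \<Longrightarrow> g t \<in> carrier G"
  by (rule PiE_mem)

lemma wreath_inverse:
  assumes "g \<in> carrier A \<rightarrow>\<^sub>E carrier G" "s \<in> carrier A"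
  defines "g' \<equiv> \<lambda>t\<in>carrier A. inv\<^bsub>G\<^esub> (g (t \<otimes>\<^bsub>A\<^esub> inv\<^bsub>A\<^esub> s))"
  shows "(g', inv\<^bsub>A\<^esub> s) \<in> carrier (wreath G A)" "(g', inv\<^bsub>A\<^esub> s) \<otimes>\<^bsub>wreath G A\<^esub> (g, s) = \<one>\<^bsub>wreath G A\<^esub>"
proof -
  show "(g', inv\<^bsub>A\<^esub> s) \<in> carrier (wreath G A)"
    using assms(1,2) by (auto simp: wreath_simps g'_def base_mem)
  show "(g', inv\<^bsub>A\<^esub> s) \<otimes>\<^bsub>wreath G A\<^esub> (g, s) = \<one>\<^bsub>wreath G A\<^esub>"
    unfolding wreath_simps using assms(1,2)
    by (auto simp: g'_def base_mem intro!: restrict_ext)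
qed

lemma group_wreath: "group (wreath G A)"
proof (rule groupI)
  fix x y assume "x \<in> carrier (wreath G A)" "y \<in> carrier (wreath G A)"
  then show "x \<otimes>\<^bsub>wreath G A\<^esub> y \<in> carrier (wreath G A)"
    by (cases x, cases y) (auto simp: wreath_simps base_mem)
  fix z assume "z \<in> carrier (wreath G A)"
  with \<open>x \<in> carrier (wreath G A)\<close> \<open>y \<in> carrier (wreath G A)\<close> show "x \<otimes>\<^bsub>wreath G A\<^esub> y \<otimes>\<^bsub>wreath G A\<^esub> z = x \<otimes>\<^bsub>wreath G A\<^esub> (y \<otimes>\<^bsub>wreath G A\<^esub> z)"
    by (cases x, cases y, cases z)
      (auto simp: wreath_simps base_mem G.m_assoc A.m_assoc intro!: restrict_ext)
next
  fix x assume x: "x \<in> carrier (wreath G A)"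
  then show "\<one>\<^bsub>wreath G A\<^esub> \<otimes>\<^bsub>wreath G A\<^esub> x = x"
    by (cases x) (auto simp: wreath_simps base_mem PiE_iff extensional_def fun_eq_iff)
  obtain g s where gs: "x = (g, s)" "g \<in> carrier A \<rightarrow>\<^sub>E carrier G" "s \<in> carrier A"
    using x by (auto simp: wreath_simps(1))
  show "\<exists>y\<in>carrier (wreath G A). y \<otimes>\<^bsub>wreath G A\<^esub> x = \<one>\<^bsub>wreath G A\<^esub>"
    unfolding gs(1) by (rule bexI, rule wreath_inverse(2)[OF gs(2,3)], rule wreath_inverse(1)[OF gs(2,3)])
qed (auto simp: wreath_simps)

lemma inv_wreath:
  assumes "g \<in> carrier A \<rightarrow>\<^sub>E carrier G" "s \<in> carrier A"
  shows "inv\<^bsub>wreath G A\<^esub> (g, s) = (\<lambda>t\<in>carrier A. inv\<^bsub>G\<^esub> (g (t \<otimes>\<^bsub>A\<^esub> inv\<^bsub>A\<^esub> s)), inv\<^bsub>A\<^esub> s)"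
  using wreath_inverse[OF assms] assms
  by (intro group.inv_equality[OF group_wreath]) (auto simp: wreath_simps(1))

lemma prod_translate_right:
  assumes "a \<in> carrier A"
  shows "(\<Prod>y\<in>carrier A. f (y \<otimes>\<^bsub>A\<^esub> a)) = (\<Prod>t\<in>carrier A. f t)"
  by (rule prod.reindex_bij_witness[of _ "\<lambda>t. t \<otimes>\<^bsub>A\<^esub> inv\<^bsub>A\<^esub> a" "\<lambda>y. y \<otimes>\<^bsub>A\<^esub> a"])
    (use assms in \<open>auto simp: A.m_assoc\<close>)

text \<open>For merging the Kronecker deltas of the single coordinates into one for whole index
  functions.\<close>

lemma prod_delta:
  "finite X \<Longrightarrow> (\<Prod>x\<in>X. if P x then f x else (0 :: 'r::{comm_semiring_1,semiring_no_zero_divisors})) =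
    (if \<forall>x\<in>X. P x then \<Prod>x\<in>X. f x else 0)"
  by (induction X rule: finite_induct) auto

text \<open>\<open>r y\<close> holds the matrix entries of irreducible representations of common
  degree \<open>d\<close>, one for each element of \<open>A\<close>. The conjunct
  \<open>x = y\<close> in \<open>r_schur\<close> says that they are pairwise inequivalent, which is
  what makes the induced representation irreducible.\<close>

context
  fixes d :: nat and r :: "'a \<Rightarrow> 'g \<Rightarrow> nat \<Rightarrow> nat \<Rightarrow> complex" and \<kappa> :: complex
  assumes d: "0 < d" and kappa: "\<kappa> \<noteq> 0"
    and r_one: "\<And>y i j. y \<in> carrier A \<Longrightarrow> i < d \<Longrightarrow> j < d \<Longrightarrow> r y \<one>\<^bsub>G\<^esub> i j = (if i = j then 1 else 0)"
    and r_mult: "\<And>y g h i j. y \<in> carrier A \<Longrightarrow> g \<in> carrier G \<Longrightarrow> h \<in> carrier G \<Longrightarrow> i < d \<Longrightarrow> j < d \<Longrightarrow>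
      r y (g \<otimes>\<^bsub>G\<^esub> h) i j = (\<Sum>k<d. r y g i k * r y h k j)"
    and r_schur: "\<And>x y i j k l. x \<in> carrier A \<Longrightarrow> y \<in> carrier A \<Longrightarrow> i < d \<Longrightarrow> j < d \<Longrightarrow> k < d \<Longrightarrow> l < d \<Longrightarrow>
      (\<Sum>g\<in>carrier G. r x (inv\<^bsub>G\<^esub> g) i j * r y g k l) = (if x = y \<and> i = l \<and> j = k then \<kappa> else 0)"
begin

definition tensor_indices :: "('a \<Rightarrow> nat) set" where "tensor_indices = carrier A \<rightarrow>\<^sub>E {..<d}"

text \<open>The representation induced from the base group: the summand \<open>a\<close> is the tensor product over
  \<open>y\<close> of \<open>r y\<close>, where \<open>r y\<close> acts through the coordinate \<open>y a\<close>. With this labelling the top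
  group only permutes the summands.\<close>

definition wreath_rep :: "('a \<Rightarrow> 'g) \<times> 'a \<Rightarrow> 'a \<times> ('a \<Rightarrow> nat) \<Rightarrow> 'a \<times> ('a \<Rightarrow> nat) \<Rightarrow> complex" where
  "wreath_rep = (\<lambda>(g, s) (a, I) (b, K).
     if a \<otimes>\<^bsub>A\<^esub> s = b then \<Prod>y\<in>carrier A. r y (g (y \<otimes>\<^bsub>A\<^esub> a)) (I y) (K y) else 0)"

lemma wreath_rep_eq: "wreath_rep (g, s) (a, I) (b, K) =
    (if a \<otimes>\<^bsub>A\<^esub> s = b then \<Prod>y\<in>carrier A. r y (g (y \<otimes>\<^bsub>A\<^esub> a)) (I y) (K y) else 0)"
  by (simp add: wreath_rep_def)

lemma tensor_indices_less: "I \<in> tensor_indices \<Longrightarrow> y \<in> carrier A \<Longrightarrow> I y < d"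
  unfolding tensor_indices_def by (auto dest: PiE_mem)

lemma tensor_indices_eq_iff: "I \<in> tensor_indices \<Longrightarrow> K \<in> tensor_indices \<Longrightarrow> I = K \<longleftrightarrow> (\<forall>y\<in>carrier A. I y = K y)"
  unfolding tensor_indices_def by (auto intro: PiE_ext)

lemma finite_tensor_indices: "finite tensor_indices"
  unfolding tensor_indices_def using fin_A by (intro finite_PiE) auto

lemma wreath_rep_one:
  assumes "a \<in> carrier A" "I \<in> tensor_indices" "b \<in> carrier A" "K \<in> tensor_indices"
  shows "wreath_rep \<one>\<^bsub>wreath G A\<^esub> (a, I) (b, K) = (if (a, I) = (b, K) then 1 else 0)"
proof -
  have "(\<Prod>y\<in>carrier A. r y ((\<lambda>t\<in>carrier A. \<one>\<^bsub>G\<^esub>) (y \<otimes>\<^bsub>A\<^esub> a)) (I y) (K y)) =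
      (\<Prod>y\<in>carrier A. if I y = K y then 1 else 0)"
    using assms by (intro prod.cong) (auto simp: r_one tensor_indices_less)
  then show ?thesis using assms fin_A unfolding wreath_simps wreath_rep_eq by (auto simp: prod_delta tensor_indices_eq_iff)
qed

text \<open>Only the summand \<open>b = a \<otimes> s\<close> contributes. There the sum over tensor
  indices factors into one sum per coordinate, each of them a matrix product for
  \<open>r y\<close>.\<close>

lemma wreath_rep_mult:
  assumes g: "g \<in> carrier A \<rightarrow>\<^sub>E carrier G" and s: "s \<in> carrier A"
    and h: "h \<in> carrier A \<rightarrow>\<^sub>E carrier G" and u: "u \<in> carrier A"
    and a: "a \<in> carrier A" "I \<in> tensor_indices" and c: "c \<in> carrier A" "K \<in> tensor_indices"
  shows "wreath_rep ((g, s) \<otimes>\<^bsub>wreath G A\<^esub> (h, u)) (a, I) (c, K) =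
    (\<Sum>x\<in>carrier A \<times> tensor_indices. wreath_rep (g, s) (a, I) x * wreath_rep (h, u) x (c, K))"
proof -
  define f where "f y k = r y (g (y \<otimes>\<^bsub>A\<^esub> a)) (I y) k * r y (h (y \<otimes>\<^bsub>A\<^esub> (a \<otimes>\<^bsub>A\<^esub> s))) k (K y)" for y k
  have "(\<Sum>x\<in>carrier A \<times> tensor_indices. wreath_rep (g, s) (a, I) x * wreath_rep (h, u) x (c, K)) =
      (\<Sum>b\<in>carrier A. \<Sum>L\<in>tensor_indices. wreath_rep (g, s) (a, I) (b, L) * wreath_rep (h, u) (b, L) (c, K))"
    by (simp add: sum.cartesian_product)
  also have "\<dots> = (\<Sum>b\<in>carrier A. if b = a \<otimes>\<^bsub>A\<^esub> s then
      (if a \<otimes>\<^bsub>A\<^esub> s \<otimes>\<^bsub>A\<^esub> u = c then \<Sum>L\<in>tensor_indices. \<Prod>y\<in>carrier A. f y (L y) else 0) else 0)"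
    by (intro sum.cong) (auto simp: wreath_rep_eq f_def prod.distrib)
  also have "\<dots> = (if a \<otimes>\<^bsub>A\<^esub> s \<otimes>\<^bsub>A\<^esub> u = c then \<Sum>L\<in>tensor_indices. \<Prod>y\<in>carrier A. f y (L y) else 0)"
    using a s fin_A by simp
  also have "(\<Sum>L\<in>tensor_indices. \<Prod>y\<in>carrier A. f y (L y)) = (\<Prod>y\<in>carrier A. \<Sum>k<d. f y k)"
    unfolding tensor_indices_def using fin_A by (simp add: prod_sum_PiE)
  also have "\<dots> = (\<Prod>y\<in>carrier A. r y ((\<lambda>t\<in>carrier A. g t \<otimes>\<^bsub>G\<^esub> h (t \<otimes>\<^bsub>A\<^esub> s)) (y \<otimes>\<^bsub>A\<^esub> a)) (I y) (K y))"
    using assms by (intro prod.cong) (auto simp: f_def r_mult base_mem tensor_indices_less A.m_assoc)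
  finally show ?thesis using a s u unfolding wreath_simps wreath_rep_eq by (simp add: A.m_assoc)
qed

text \<open>The first factor forces \<open>s = inv b \<otimes> a\<close>. The sum over the base
  group then splits into a product over the coordinates \<open>t\<close> of Schur sums for
  \<open>r (t \<otimes> inv b)\<close> and \<open>r (t \<otimes> inv c)\<close>. If
  \<open>b \<noteq> c\<close> these are inequivalent and the product vanishes; if
  \<open>b = c\<close> and the tensor indices match, each coordinate contributes
  \<open>\<kappa>\<close>.\<close>

lemma wreath_rep_schur:
  assumes a: "a \<in> carrier A" "I \<in> tensor_indices" and b: "b \<in> carrier A" "K \<in> tensor_indices"
    and c: "c \<in> carrier A" "L \<in> tensor_indices" and e: "e \<in> carrier A" "M \<in> tensor_indices"
  shows "(\<Sum>x\<in>carrier (wreath G A). wreath_rep (inv\<^bsub>wreath G A\<^esub> x) (a, I) (b, K) * wreath_rep x (c, L) (e, M)) =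
    (if (a, I) = (e, M) \<and> (b, K) = (c, L) then \<kappa> ^ card (carrier A) else 0)"
proof -
  define ib ic where "ib = inv\<^bsub>A\<^esub> b" and "ic = inv\<^bsub>A\<^esub> c"
  have ibc: "ib \<in> carrier A" "ic \<in> carrier A" using b c by (auto simp: ib_def ic_def)
  \<comment> \<open>The substitutions are \<open>t = y \<otimes> b\<close> in the factor of the
    inverse and \<open>t = y \<otimes> c\<close> in the other one, so that both involve the base
    element through \<open>g t\<close> only.\<close>
  define f where "f t x = r (t \<otimes>\<^bsub>A\<^esub> ib) (inv\<^bsub>G\<^esub> x) (I (t \<otimes>\<^bsub>A\<^esub> ib)) (K (t \<otimes>\<^bsub>A\<^esub> ib)) *
    r (t \<otimes>\<^bsub>A\<^esub> ic) x (L (t \<otimes>\<^bsub>A\<^esub> ic)) (M (t \<otimes>\<^bsub>A\<^esub> ic))" for t x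
  have term1: "wreath_rep (inv\<^bsub>wreath G A\<^esub> (g, s)) (a, I) (b, K) * wreath_rep (g, s) (c, L) (e, M) =
    (if s = ib \<otimes>\<^bsub>A\<^esub> a then (if c \<otimes>\<^bsub>A\<^esub> (ib \<otimes>\<^bsub>A\<^esub> a) = e then \<Prod>t\<in>carrier A. f t (g t) else 0) else 0)"
    if g: "g \<in> carrier A \<rightarrow>\<^sub>E carrier G" and s: "s \<in> carrier A" for g s
  proof -
    have as: "a \<otimes>\<^bsub>A\<^esub> inv\<^bsub>A\<^esub> s = b \<longleftrightarrow> s = ib \<otimes>\<^bsub>A\<^esub> a"
      using a b s unfolding ib_def
      by (metis A.inv_closed A.inv_inv A.inv_mult_group A.inv_solve_left A.inv_solve_right)
    show ?thesis
    proof (cases "s = ib \<otimes>\<^bsub>A\<^esub> a \<and> c \<otimes>\<^bsub>A\<^esub> s = e")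
      case True
      have ab: "a \<otimes>\<^bsub>A\<^esub> inv\<^bsub>A\<^esub> s = b" using True as by blast
      have "(\<Prod>y\<in>carrier A. r y ((\<lambda>t\<in>carrier A. inv\<^bsub>G\<^esub> (g (t \<otimes>\<^bsub>A\<^esub> inv\<^bsub>A\<^esub> s))) (y \<otimes>\<^bsub>A\<^esub> a)) (I y) (K y)) =
        (\<Prod>y\<in>carrier A. r (y \<otimes>\<^bsub>A\<^esub> b \<otimes>\<^bsub>A\<^esub> ib) (inv\<^bsub>G\<^esub> (g (y \<otimes>\<^bsub>A\<^esub> b))) (I (y \<otimes>\<^bsub>A\<^esub> b \<otimes>\<^bsub>A\<^esub> ib)) (K (y \<otimes>\<^bsub>A\<^esub> b \<otimes>\<^bsub>A\<^esub> ib)))"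
        using a b s ab by (intro prod.cong) (auto simp: A.m_assoc ib_def)
      also have "\<dots> = (\<Prod>t\<in>carrier A. r (t \<otimes>\<^bsub>A\<^esub> ib) (inv\<^bsub>G\<^esub> (g t)) (I (t \<otimes>\<^bsub>A\<^esub> ib)) (K (t \<otimes>\<^bsub>A\<^esub> ib)))"
        by (rule prod_translate_right[OF b(1), of "\<lambda>t. r (t \<otimes>\<^bsub>A\<^esub> ib) (inv\<^bsub>G\<^esub> (g t)) (I (t \<otimes>\<^bsub>A\<^esub> ib)) (K (t \<otimes>\<^bsub>A\<^esub> ib))"])
      finally have 1: "wreath_rep (inv\<^bsub>wreath G A\<^esub> (g, s)) (a, I) (b, K) =
        (\<Prod>t\<in>carrier A. r (t \<otimes>\<^bsub>A\<^esub> ib) (inv\<^bsub>G\<^esub> (g t)) (I (t \<otimes>\<^bsub>A\<^esub> ib)) (K (t \<otimes>\<^bsub>A\<^esub> ib)))"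
        using ab by (simp add: inv_wreath[OF g s] wreath_rep_eq)
      have "(\<Prod>y\<in>carrier A. r y (g (y \<otimes>\<^bsub>A\<^esub> c)) (L y) (M y)) =
        (\<Prod>y\<in>carrier A. r (y \<otimes>\<^bsub>A\<^esub> c \<otimes>\<^bsub>A\<^esub> ic) (g (y \<otimes>\<^bsub>A\<^esub> c)) (L (y \<otimes>\<^bsub>A\<^esub> c \<otimes>\<^bsub>A\<^esub> ic)) (M (y \<otimes>\<^bsub>A\<^esub> c \<otimes>\<^bsub>A\<^esub> ic)))"
        using c by (intro prod.cong) (auto simp: A.m_assoc ic_def)
      also have "\<dots> = (\<Prod>t\<in>carrier A. r (t \<otimes>\<^bsub>A\<^esub> ic) (g t) (L (t \<otimes>\<^bsub>A\<^esub> ic)) (M (t \<otimes>\<^bsub>A\<^esub> ic)))"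
        by (rule prod_translate_right[OF c(1), of "\<lambda>t. r (t \<otimes>\<^bsub>A\<^esub> ic) (g t) (L (t \<otimes>\<^bsub>A\<^esub> ic)) (M (t \<otimes>\<^bsub>A\<^esub> ic))"])
      finally have 2: "wreath_rep (g, s) (c, L) (e, M) =
        (\<Prod>t\<in>carrier A. r (t \<otimes>\<^bsub>A\<^esub> ic) (g t) (L (t \<otimes>\<^bsub>A\<^esub> ic)) (M (t \<otimes>\<^bsub>A\<^esub> ic)))"
        using conjunct2[OF True] by (simp add: wreath_rep_eq)
      have "c \<otimes>\<^bsub>A\<^esub> (ib \<otimes>\<^bsub>A\<^esub> a) = e" using True by blast
      then show ?thesis unfolding 1 2 using True by (simp add: f_def prod.distrib)
    next
      case False
      then show ?thesis using as by (auto simp: inv_wreath[OF g s] wreath_rep_eq)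
    qed
  qed
  have sum_f: "(\<Sum>x\<in>carrier G. f t x) = (if b = c \<and> I (t \<otimes>\<^bsub>A\<^esub> ib) = M (t \<otimes>\<^bsub>A\<^esub> ib) \<and> K (t \<otimes>\<^bsub>A\<^esub> ib) = L (t \<otimes>\<^bsub>A\<^esub> ib) then \<kappa> else 0)"
    if "t \<in> carrier A" for t
  proof -
    have "t \<otimes>\<^bsub>A\<^esub> ib = t \<otimes>\<^bsub>A\<^esub> ic \<longleftrightarrow> b = c"
      using that ibc b c unfolding ib_def ic_def by (metis A.inv_inv A.Units_eq A.Units_l_cancel A.inv_closed)
    moreover have "ib = ic" if "b = c" using that by (simp add: ib_def ic_def)
    ultimately show ?thesis
      unfolding f_def using that ibc assms by (subst r_schur) (auto simp: tensor_indices_less)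
  qed
  have all: "(\<forall>t\<in>carrier A. P (t \<otimes>\<^bsub>A\<^esub> ib)) \<longleftrightarrow> (\<forall>y\<in>carrier A. P y)" for P
  proof (intro iffI ballI)
    fix y assume P: "\<forall>t\<in>carrier A. P (t \<otimes>\<^bsub>A\<^esub> ib)" and y: "y \<in> carrier A"
    have "P ((y \<otimes>\<^bsub>A\<^esub> b) \<otimes>\<^bsub>A\<^esub> ib)" using P y b by blast
    then show "P y" using y b by (simp add: ib_def A.m_assoc)
  qed (use ibc in auto)
  have ne: "carrier A \<noteq> {}" using A.one_closed by blast
  have "(\<Sum>x\<in>carrier (wreath G A). wreath_rep (inv\<^bsub>wreath G A\<^esub> x) (a, I) (b, K) * wreath_rep x (c, L) (e, M)) =
      (\<Sum>g\<in>carrier A \<rightarrow>\<^sub>E carrier G. \<Sum>s\<in>carrier A. wreath_rep (inv\<^bsub>wreath G A\<^esub> (g, s)) (a, I) (b, K) * wreath_rep (g, s) (c, L) (e, M))"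
    unfolding wreath_simps(1) by (simp add: sum.cartesian_product)
  also have "\<dots> = (\<Sum>g\<in>carrier A \<rightarrow>\<^sub>E carrier G. if c \<otimes>\<^bsub>A\<^esub> (ib \<otimes>\<^bsub>A\<^esub> a) = e then \<Prod>t\<in>carrier A. f t (g t) else 0)"
    using a ibc fin_A by (simp add: term1)
  also have "\<dots> = (if c \<otimes>\<^bsub>A\<^esub> (ib \<otimes>\<^bsub>A\<^esub> a) = e then \<Prod>t\<in>carrier A. \<Sum>x\<in>carrier G. f t x else 0)"
    using fin_A fin_G by (simp add: prod_sum_PiE)
  also have "(\<Prod>t\<in>carrier A. \<Sum>x\<in>carrier G. f t x) =
      (if b = c \<and> I = M \<and> K = L then \<kappa> ^ card (carrier A) else 0)"
  proof -
    have "(\<Prod>t\<in>carrier A. \<Sum>x\<in>carrier G. f t x) =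
      (if \<forall>t\<in>carrier A. b = c \<and> I (t \<otimes>\<^bsub>A\<^esub> ib) = M (t \<otimes>\<^bsub>A\<^esub> ib) \<and> K (t \<otimes>\<^bsub>A\<^esub> ib) = L (t \<otimes>\<^bsub>A\<^esub> ib)
       then \<kappa> ^ card (carrier A) else 0)"
      using fin_A by (simp add: sum_f prod_delta)
    also have "(\<forall>t\<in>carrier A. b = c \<and> I (t \<otimes>\<^bsub>A\<^esub> ib) = M (t \<otimes>\<^bsub>A\<^esub> ib) \<and> K (t \<otimes>\<^bsub>A\<^esub> ib) = L (t \<otimes>\<^bsub>A\<^esub> ib)) \<longleftrightarrow>
      b = c \<and> I = M \<and> K = L"
      unfolding all[of "\<lambda>y. b = c \<and> I y = M y \<and> K y = L y"] using ne assms by (auto simp: tensor_indices_eq_iff)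
    finally show ?thesis .
  qed
  also have "(if c \<otimes>\<^bsub>A\<^esub> (ib \<otimes>\<^bsub>A\<^esub> a) = e then (if b = c \<and> I = M \<and> K = L then \<kappa> ^ card (carrier A) else 0) else 0) =
      (if (a, I) = (e, M) \<and> (b, K) = (c, L) then \<kappa> ^ card (carrier A) else 0)"
  proof -
    \<comment> \<open>For \<open>b = c\<close> the remaining condition on \<open>e\<close> becomes
      \<open>a = e\<close>.\<close>
    have "c \<otimes>\<^bsub>A\<^esub> (ib \<otimes>\<^bsub>A\<^esub> a) = a" if "b = c"
      using that a c by (simp add: ib_def flip: A.m_assoc)
    then show ?thesis by auto
  qed
  finally show ?thesis .
qed

text \<open>A diagonal entry can be nonzero only if \<open>a \<otimes> s = a\<close>, so the trace
  lives on the base group; there the sum over tensor indices of products is a product of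
  traces.\<close>

lemma irr_char_wreath:
  "irr_char (wreath G A) (\<lambda>(g, s). if s = \<one>\<^bsub>A\<^esub> then
     \<Sum>a\<in>carrier A. \<Prod>y\<in>carrier A. \<Sum>i<d. r y (g (y \<otimes>\<^bsub>A\<^esub> a)) i i else 0)"
proof -
  let ?I = "carrier A \<times> tensor_indices"
  have fin: "finite ?I" using fin_A finite_tensor_indices by simp
  have "(\<lambda>y\<in>carrier A. 0) \<in> tensor_indices" using d by (auto simp: tensor_indices_def)
  then have "?I \<noteq> {}" using A.one_closed by blast
  then have pos: "0 < card ?I" using fin by (simp add: card_gt_0_iff)
  obtain e where e: "bij_betw e {..<card ?I} ?I"
    using ex_bij_betw_nat_finite[OF fin] by (auto simp: atLeast0LessThan)
  have "irreducible_rep (wreath G A) (card ?I) (\<lambda>x. mat (card ?I) (card ?I) (\<lambda>(i, j). wreath_rep x (e i) (e j)))"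
  proof (rule irreducible_rep_if_schur_relations[OF group_wreath finite_wreath e pos])
    show "\<kappa> ^ card (carrier A) \<noteq> 0" using kappa by simp
  next
    fix i j assume "i \<in> ?I" "j \<in> ?I"
    then show "wreath_rep \<one>\<^bsub>wreath G A\<^esub> i j = (if i = j then 1 else 0)" by (cases i, cases j) (simp only: mem_Sigma_iff wreath_rep_one)
  next
    fix x y i j assume "x \<in> carrier (wreath G A)" "y \<in> carrier (wreath G A)" "i \<in> ?I" "j \<in> ?I"
    then show "wreath_rep (x \<otimes>\<^bsub>wreath G A\<^esub> y) i j = (\<Sum>k\<in>?I. wreath_rep x i k * wreath_rep y k j)"
      by (cases x, cases y, cases i, cases j) (simp only: mem_Sigma_iff wreath_simps(1) wreath_rep_mult)
  next
    fix i j k l assume "i \<in> ?I" "j \<in> ?I" "k \<in> ?I" "l \<in> ?I"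
    then show "(\<Sum>x\<in>carrier (wreath G A). wreath_rep (inv\<^bsub>wreath G A\<^esub> x) i j * wreath_rep x k l) = (if i = l \<and> j = k then \<kappa> ^ card (carrier A) else 0)"
      by (cases i, cases j, cases k, cases l) (simp only: mem_Sigma_iff wreath_rep_schur)
  qed
  moreover have "(case x of (g, s) \<Rightarrow> if s = \<one>\<^bsub>A\<^esub> then
      \<Sum>a\<in>carrier A. \<Prod>y\<in>carrier A. \<Sum>i<d. r y (g (y \<otimes>\<^bsub>A\<^esub> a)) i i else 0) =
    mat_trace (mat (card ?I) (card ?I) (\<lambda>(i, j). wreath_rep x (e i) (e j)))" if x: "x \<in> carrier (wreath G A)" for x
  proof -
    obtain g s where gs: "x = (g, s)" "s \<in> carrier A" using x by (auto simp: wreath_simps(1))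
    have "mat_trace (mat (card ?I) (card ?I) (\<lambda>(i, j). wreath_rep x (e i) (e j))) = (\<Sum>i<card ?I. wreath_rep x (e i) (e i))"
      unfolding mat_trace_def by simp
    also have "\<dots> = (\<Sum>i\<in>?I. wreath_rep x i i)" by (rule sum.reindex_bij_betw[OF e])
    also have "\<dots> = (\<Sum>a\<in>carrier A. \<Sum>I\<in>tensor_indices. wreath_rep x (a, I) (a, I))" by (simp add: sum.cartesian_product)
    also have "\<dots> = (\<Sum>a\<in>carrier A. if s = \<one>\<^bsub>A\<^esub> then \<Prod>y\<in>carrier A. \<Sum>i<d. r y (g (y \<otimes>\<^bsub>A\<^esub> a)) i i else 0)"
      using gs fin_A by (intro sum.cong refl) (simp add: wreath_rep_eq prod_sum_PiE tensor_indices_def)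
    finally show ?thesis using gs by simp
  qed
  ultimately show ?thesis unfolding irr_char_def by blast
qed

end

end

section \<open>Conjugate characters and the main theorem\<close>

context
  fixes G :: "('g, 'b) monoid_scheme" (structure) and \<chi> :: "'g \<Rightarrow> complex" and d :: nat and \<rho> :: "'g \<Rightarrow> complex mat"
  assumes grp: "group G" and fin: "finite (carrier G)"
    and irr: "irreducible_rep G d \<rho>" and trace: "\<And>g. g \<in> carrier G \<Longrightarrow> \<chi> g = mat_trace (\<rho> g)"
begin

interpretation group G by (rule grp)

lemma is_rep_rho: "is_rep G d \<rho>" and dim_pos: "0 < d"
  using irr unfolding irreducible_rep_def by auto

text \<open>The eigenvalues of \<open>\<rho> g\<close> are roots of unity, all of which \<open>\<phi>\<close> raises to a common power \<open>k\<close>;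
  hence \<open>\<phi> (\<chi> g) = \<chi> (g\<^sup>k)\<close>.\<close>

lemma hom_char_value:
  assumes "field_hom_on (char_field G \<chi>) \<phi>" and g: "g \<in> carrier G"
  shows "\<phi> (\<chi> g) \<in> \<chi> ` carrier G"
proof -
  define N where "N = Coset.order G"
  have N: "N > 0" unfolding N_def using fin by (simp add: order_gt_0_iff_finite)
  define \<zeta> where "\<zeta> = cis (2 * pi / real N)"
  have \<zeta>_pow: "\<zeta> ^ k = cis (2 * pi * real k / real N)" for k
    by (simp add: \<zeta>_def DeMoivre mult.commute)
  have root: "\<exists>k. z = \<zeta> ^ k" if "z ^ N = 1" for z
    using that bij_betw_roots_unity[OF N] unfolding \<zeta>_pow bij_betw_def by blast
  obtain lam where lam: "\<And>i. i < d \<Longrightarrow> lam i ^ N = 1"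
    and tr: "\<And>k. mat_trace (\<rho> (g [^] (k :: nat))) = (\<Sum>i<d. lam i ^ k)"
    unfolding N_def using rep_trace_eigenvalues[OF grp fin is_rep_rho g] by metis
  interpret E: subfield_hom "char_field G \<chi>" \<phi>
    using assms(1) is_subfield_gen_field by unfold_locales (simp_all add: char_field_def)
  have "countable (char_field G \<chi>)"
    unfolding char_field_def using fin by (intro countable_gen_field) simp
  \<comment> \<open>The eigenvalues need not lie in the field of character values, so
    \<open>\<phi>\<close> is extended to a primitive \<open>N\<close>-th root of unity; its image is
    again an \<open>N\<close>-th root of unity and provides \<open>k\<close>.\<close>
  then obtain L \<psi> where L: "is_subfield L" "char_field G \<chi> \<subseteq> L" "{\<zeta>} \<subseteq> L" "field_hom_on L \<psi>"
    "\<And>k. k \<in> char_field G \<chi> \<Longrightarrow> \<psi> k = \<phi> k"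
    by (rule E.extend_hom_finite[of "{\<zeta>}"]) auto
  interpret L: subfield_hom L \<psi> by unfold_locales (rule L)+
  have "\<zeta> \<in> L" using L(3) by simp
  have "\<psi> \<zeta> ^ N = \<psi> (\<zeta> ^ N)" using L.hom_power[OF \<open>\<zeta> \<in> L\<close>] by simp
  also have "\<dots> = 1" using N by (simp add: \<zeta>_pow)
  finally obtain k where k: "\<psi> \<zeta> = \<zeta> ^ k" using root by blast
  have lam_psi: "lam i \<in> L" "\<psi> (lam i) = lam i ^ k" if i: "i < d" for i
  proof -
    obtain m where m: "lam i = \<zeta> ^ m" using root[OF lam[OF i]] by blast
    show "lam i \<in> L" unfolding m by (rule L.power_mem[OF \<open>\<zeta> \<in> L\<close>])
    show "\<psi> (lam i) = lam i ^ k"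
      unfolding m L.hom_power[OF \<open>\<zeta> \<in> L\<close>] k by (simp add: mult.commute flip: power_mult)
  qed
  have "\<chi> g \<in> char_field G \<chi>"
    using g gen_field_superset[of "\<chi> ` carrier G"] unfolding char_field_def by blast
  then have "\<phi> (\<chi> g) = \<psi> (\<chi> g)" using L(5) by simp
  also have "\<dots> = \<psi> (\<Sum>i<d. lam i)" using tr[of 1] g by (simp add: trace)
  also have "\<dots> = (\<Sum>i<d. lam i ^ k)" using lam_psi by (subst L.hom_sum) auto
  also have "\<dots> = \<chi> (g [^] k)" using tr[of k] g by (simp add: trace)
  finally show ?thesis using g by simp
qed

lemma normal_field_char_field: "normal_field (\<chi> ` carrier G) (char_field G \<chi>)"
proof
  show "finite (\<chi> ` carrier G)" using fin by simp
  show "char_field G \<chi> = gen_field (\<chi> ` carrier G)" by (simp add: char_field_def)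
  show "\<phi> ` \<chi> ` carrier G \<subseteq> \<chi> ` carrier G" if "field_hom_on (char_field G \<chi>) \<phi>" for \<phi>
    using hom_char_value[OF that] by blast
qed

interpretation E: normal_field "\<chi> ` carrier G" "char_field G \<chi>"
  by (rule normal_field_char_field)

text \<open>\<open>\<phi>\<close> is extended to the finitely many matrix entries and applied
  entrywise. The constant \<open>\<kappa>\<close> of the Schur relations is rational, hence fixed,
  so the criterion for irreducibility applies to the result.\<close>

lemma conjugate_rep_exists:
  assumes "field_hom_on (char_field G \<chi>) \<phi>"
  shows "\<exists>\<rho>'. irreducible_rep G d \<rho>' \<and> (\<forall>g\<in>carrier G. mat_trace (\<rho>' g) = \<phi> (\<chi> g))"
proof -
  define T where "T = (\<lambda>(g, i, j). \<rho> g $$ (i, j)) ` (carrier G \<times> {..<d} \<times> {..<d})"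
  have T: "finite T" unfolding T_def using fin by simp
  interpret E': subfield_hom "char_field G \<chi>" \<phi>
    by unfold_locales (rule assms)
  obtain L \<psi> where L: "is_subfield L" "char_field G \<chi> \<subseteq> L" "T \<subseteq> L" "field_hom_on L \<psi>"
    "\<And>k. k \<in> char_field G \<chi> \<Longrightarrow> \<psi> k = \<phi> k"
    by (rule E'.extend_hom_finite[OF E.countable_E T]) blast
  interpret L: subfield_hom L \<psi> by unfold_locales (rule L)+
  have entry: "\<rho> g $$ (i, j) \<in> L" if "g \<in> carrier G" "i < d" "j < d" for g i j
    using that L(3) unfolding T_def by (force simp: image_subset_iff)
  have \<rho>: "\<rho> g \<in> carrier_mat d d" if "g \<in> carrier G" for g
    using is_rep_rho that unfolding is_rep_def by blast
  define \<kappa> :: complex where "\<kappa> = of_nat (Coset.order G) / of_nat d"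
  have "irreducible_rep G d (\<lambda>g. mat d d (\<lambda>(i, j). \<psi> (\<rho> g $$ (id i, id j))))"
  proof (rule irreducible_rep_if_schur_relations[OF grp fin, where \<kappa> = \<kappa> and I = "{..<d}"])
    show "bij_betw id {..<d} {..<d}" by simp
    show "0 < d" by (rule dim_pos)
    show "\<kappa> \<noteq> 0" using fin dim_pos order_gt_0_iff_finite by (simp add: \<kappa>_def)
  next
    fix i j assume "i \<in> {..<d}" "j \<in> {..<d}"
    then show "\<psi> (\<rho> \<one> $$ (i, j)) = (if i = j then 1 else 0)"
      using is_rep_rho by (auto simp: is_rep_def)
  next
    fix g h i j assume gh: "g \<in> carrier G" "h \<in> carrier G" and "i \<in> {..<d}" "j \<in> {..<d}"
    then have ij: "i < d" "j < d" by auto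
    have "\<rho> (g \<otimes> h) = \<rho> g * \<rho> h" using is_rep_rho gh unfolding is_rep_def by blast
    then have "\<rho> (g \<otimes> h) $$ (i, j) = (\<Sum>k<d. \<rho> g $$ (i, k) * \<rho> h $$ (k, j))"
      using mult_mat_index[OF \<rho>[OF gh(1)] \<rho>[OF gh(2)] ij] by simp
    then show "\<psi> (\<rho> (g \<otimes> h) $$ (i, j)) = (\<Sum>k<d. \<psi> (\<rho> g $$ (i, k)) * \<psi> (\<rho> h $$ (k, j)))"
      using gh ij by (simp only:, subst L.hom_sum) (auto simp: L.hom_mult entry L.mult_mem)
  next
    fix i j k l assume "i \<in> {..<d}" "j \<in> {..<d}" "k \<in> {..<d}" "l \<in> {..<d}"
    then have ijkl: "i < d" "j < d" "k < d" "l < d" by auto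
    have "(\<Sum>g\<in>carrier G. \<psi> (\<rho> (inv g) $$ (i, j)) * \<psi> (\<rho> g $$ (k, l))) =
      \<psi> (\<Sum>g\<in>carrier G. \<rho> (inv g) $$ (i, j) * \<rho> g $$ (k, l))"
      using ijkl by (subst L.hom_sum) (auto simp: L.hom_mult entry L.mult_mem)
    also have "\<dots> = (if i = l \<and> j = k then \<kappa> else 0)"
      unfolding schur_orthogonality[OF grp fin irr ijkl] \<kappa>_def by (simp add: L.hom_divide)
    finally show "(\<Sum>g\<in>carrier G. \<psi> (\<rho> (inv g) $$ (i, j)) * \<psi> (\<rho> g $$ (k, l))) =
      (if i = l \<and> j = k then \<kappa> else 0)" .
  qed
  moreover have "mat_trace (mat d d (\<lambda>(i, j). \<psi> (\<rho> g $$ (id i, id j)))) = \<phi> (\<chi> g)" if g: "g \<in> carrier G" for g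
  proof -
    have "\<chi> g \<in> char_field G \<chi>" using g E.gens_subset by blast
    then have "\<phi> (\<chi> g) = \<psi> (\<chi> g)" using L(5) by simp
    also have "\<dots> = (\<Sum>i<d. \<psi> (\<rho> g $$ (i, i)))"
      unfolding trace[OF g] mat_trace_eq[OF \<rho>[OF g]] using g by (intro L.hom_sum) (simp add: entry)
    finally show ?thesis by (simp add: mat_trace_def)
  qed
  ultimately show ?thesis by blast
qed

text \<open>The representations are chosen for all automorphisms at once. Distinct automorphisms
  differ at a character value, so their representations have different traces and the mixed sums
  vanish.\<close>

lemma conjugate_reps:
  obtains \<rho>s where "\<And>\<sigma>. \<sigma> \<in> E.Gal {} \<Longrightarrow> irreducible_rep G d (\<rho>s \<sigma>)"
    "\<And>\<sigma> g. \<sigma> \<in> E.Gal {} \<Longrightarrow> g \<in> carrier G \<Longrightarrow> mat_trace (\<rho>s \<sigma> g) = \<sigma> (\<chi> g)"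
    "\<And>\<sigma> \<tau> i j k l. \<sigma> \<in> E.Gal {} \<Longrightarrow> \<tau> \<in> E.Gal {} \<Longrightarrow> i < d \<Longrightarrow> j < d \<Longrightarrow> k < d \<Longrightarrow> l < d \<Longrightarrow>
      (\<Sum>g\<in>carrier G. \<rho>s \<sigma> (inv g) $$ (i, j) * \<rho>s \<tau> g $$ (k, l)) =
      (if \<sigma> = \<tau> \<and> i = l \<and> j = k then of_nat (Coset.order G) / of_nat d else 0)"
proof -
  have "\<forall>\<sigma>\<in>E.Gal {}. \<exists>\<rho>'. irreducible_rep G d \<rho>' \<and> (\<forall>g\<in>carrier G. mat_trace (\<rho>' g) = \<sigma> (\<chi> g))"
    using conjugate_rep_exists E.Gal_hom by blast
  from bchoice[OF this] obtain \<rho>s where irrs: "\<And>\<sigma>. \<sigma> \<in> E.Gal {} \<Longrightarrow> irreducible_rep G d (\<rho>s \<sigma>)"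
    and tr: "\<And>\<sigma> g. \<sigma> \<in> E.Gal {} \<Longrightarrow> g \<in> carrier G \<Longrightarrow> mat_trace (\<rho>s \<sigma> g) = \<sigma> (\<chi> g)"
    by blast
  show ?thesis
  proof (rule that[OF irrs tr])
    fix \<sigma> \<tau> i j k l assume st: "\<sigma> \<in> E.Gal {}" "\<tau> \<in> E.Gal {}" and ijkl: "i < d" "j < d" "k < d" "l < d"
    show "(\<Sum>g\<in>carrier G. \<rho>s \<sigma> (inv g) $$ (i, j) * \<rho>s \<tau> g $$ (k, l)) =
      (if \<sigma> = \<tau> \<and> i = l \<and> j = k then of_nat (Coset.order G) / of_nat d else 0)"
    proof (cases "\<sigma> = \<tau>")
      case True
      then show ?thesis using schur_orthogonality[OF grp fin irrs[OF st(2)] ijkl] by simp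
    next
      case False
      then obtain h where h: "h \<in> carrier G" "\<tau> (\<chi> h) \<noteq> \<sigma> (\<chi> h)" using E.Gal_eqI[OF st] by force
      have "mat_trace (\<rho>s \<tau> h) \<noteq> mat_trace (\<rho>s \<sigma> h)" using h tr st by simp
      moreover have "is_rep G d (\<rho>s \<sigma>)" using irrs[OF st(1)] unfolding irreducible_rep_def by blast
      ultimately show ?thesis
        using schur_orthogonality_distinct[OF grp fin irrs[OF st(2)] _ h(1) _ ijkl] False by simp
    qed
  qed
qed

text \<open>The entrywise relations are summed over pairs of diagonal positions: only
  \<open>i = k\<close> survives, and \<open>d\<close> terms, each the group order divided by
  \<open>d\<close>, make up the group order.\<close>

lemma conjugate_character_orthogonality:
  assumes st: "\<sigma> \<in> E.Gal {}" "\<tau> \<in> E.Gal {}"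
  shows "(\<Sum>g\<in>carrier G. \<sigma> (\<chi> (inv g)) * \<tau> (\<chi> g)) = (if \<sigma> = \<tau> then of_nat (Coset.order G) else 0)"
proof -
  obtain \<rho>s where irrs: "\<And>\<sigma>. \<sigma> \<in> E.Gal {} \<Longrightarrow> irreducible_rep G d (\<rho>s \<sigma>)"
    and tr: "\<And>\<sigma> g. \<sigma> \<in> E.Gal {} \<Longrightarrow> g \<in> carrier G \<Longrightarrow> mat_trace (\<rho>s \<sigma> g) = \<sigma> (\<chi> g)"
    and orth: "\<And>\<sigma> \<tau> i j k l. \<sigma> \<in> E.Gal {} \<Longrightarrow> \<tau> \<in> E.Gal {} \<Longrightarrow> i < d \<Longrightarrow> j < d \<Longrightarrow> k < d \<Longrightarrow> l < d \<Longrightarrow>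
      (\<Sum>g\<in>carrier G. \<rho>s \<sigma> (inv g) $$ (i, j) * \<rho>s \<tau> g $$ (k, l)) =
      (if \<sigma> = \<tau> \<and> i = l \<and> j = k then of_nat (Coset.order G) / of_nat d else 0)"
    by (rule conjugate_reps) blast
  have val: "\<sigma> (\<chi> g) = (\<Sum>i<d. \<rho>s \<sigma> g $$ (i, i))" if "\<sigma> \<in> E.Gal {}" "g \<in> carrier G" for \<sigma> g
  proof -
    have "\<rho>s \<sigma> g \<in> carrier_mat d d" using irrs that unfolding irreducible_rep_def is_rep_def by blast
    then show ?thesis using tr[OF that] by (simp add: mat_trace_eq)
  qed
  have "(\<Sum>g\<in>carrier G. \<sigma> (\<chi> (inv g)) * \<tau> (\<chi> g)) =
    (\<Sum>g\<in>carrier G. \<Sum>i<d. \<Sum>k<d. \<rho>s \<sigma> (inv g) $$ (i, i) * \<rho>s \<tau> g $$ (k, k))"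
    by (intro sum.cong refl) (simp add: val st sum_product)
  also have "\<dots> = (\<Sum>i<d. \<Sum>k<d. \<Sum>g\<in>carrier G. \<rho>s \<sigma> (inv g) $$ (i, i) * \<rho>s \<tau> g $$ (k, k))"
    by (subst sum.swap, rule sum.cong[OF refl], rule sum.swap)
  also have "\<dots> = (\<Sum>i<d. \<Sum>k<d. if k = i then (if \<sigma> = \<tau> then of_nat (Coset.order G) / of_nat d else 0) else 0)"
    by (intro sum.cong refl) (auto simp: orth[OF st])
  also have "\<dots> = (if \<sigma> = \<tau> then of_nat (Coset.order G) else 0)"
    using dim_pos by simp
  finally show ?thesis .
qed

section \<open>Descent to the subfield \<open>F\<close> and the character of the wreath
  product\<close>

context
  fixes F :: "complex set"
  assumes F: "is_subfield F" "F \<subseteq> char_field G \<chi>"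
begin

text \<open>The relative trace from E to \<open>F\<close> of the value at \<open>g\<close> of the
  tensor product character whose factor at \<open>t\<close> is the conjugate of
  \<open>\<chi>\<close> by the inverse of \<open>t\<close>. In \<open>wreath_character\<close> it
  turns out to be the induced character on the base group.\<close>

definition base_character :: "((complex \<Rightarrow> complex) \<Rightarrow> 'g) \<Rightarrow> complex" where
  "base_character g = (\<Sum>a\<in>E.Gal F. a (\<Prod>t\<in>E.Gal F. inv_into UNIV t (\<chi> (g t))))"

lemma A_sub: "E.Gal F \<subseteq> E.Gal {}"
  by (rule E.Gal_antimono) simp

lemma inv_A: "t \<in> E.Gal F \<Longrightarrow> inv_into UNIV t \<in> E.Gal {}"
  using E.inv_Gal A_sub by blast

lemma conjugate_value_mem: "g \<in> (E.Gal F \<rightarrow>\<^sub>E carrier G) \<Longrightarrow> t \<in> E.Gal F \<Longrightarrow> inv_into UNIV t (\<chi> (g t)) \<in> char_field G \<chi>"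
  using E.Gal_mem[OF inv_A] E.gens_subset by (blast dest: PiE_mem)

text \<open>\<open>X\<close> is left free since the lemma is used for \<open>Gal F\<close>, to
  descend to \<open>F\<close>, and for \<open>Gal {}\<close>, to separate automorphisms.\<close>

lemma comp_base_character:
  assumes \<tau>: "\<tau> \<in> E.Gal X" and g: "g \<in> (E.Gal F \<rightarrow>\<^sub>E carrier G)"
  shows "\<tau> (base_character g) = (\<Sum>a\<in>E.Gal F. \<Prod>t\<in>E.Gal F. (\<tau> \<circ> a) (inv_into UNIV t (\<chi> (g t))))"
proof -
  interpret t: subfield_hom "char_field G \<chi>" \<tau> using \<tau> by (rule E.Gal_field_hom)
  have mem: "(\<Prod>t\<in>E.Gal F. inv_into UNIV t (\<chi> (g t))) \<in> char_field G \<chi>"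
    using conjugate_value_mem[OF g] by (rule E.prod_mem)
  have "\<tau> (base_character g) = (\<Sum>a\<in>E.Gal F. (\<tau> \<circ> a) (\<Prod>t\<in>E.Gal F. inv_into UNIV t (\<chi> (g t))))"
    unfolding base_character_def by (subst t.hom_sum) (auto intro: E.Gal_mem mem)
  also have "\<dots> = (\<Sum>a\<in>E.Gal F. \<Prod>t\<in>E.Gal F. (\<tau> \<circ> a) (inv_into UNIV t (\<chi> (g t))))"
  proof (rule sum.cong[OF refl])
    fix a assume "a \<in> E.Gal F"
    then have "a \<in> E.Gal {}" "\<tau> \<in> E.Gal {}" using A_sub \<tau> E.Gal_antimono[of "{}" X] by auto
    then have "\<tau> \<circ> a \<in> E.Gal {}" by (intro E.comp_Gal)
    then interpret ta: subfield_hom "char_field G \<chi>" "\<tau> \<circ> a" by (rule E.Gal_field_hom)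
    show "(\<tau> \<circ> a) (\<Prod>t\<in>E.Gal F. inv_into UNIV t (\<chi> (g t))) = (\<Prod>t\<in>E.Gal F. (\<tau> \<circ> a) (inv_into UNIV t (\<chi> (g t))))"
      by (rule ta.hom_prod[OF conjugate_value_mem[OF g]])
  qed
  finally show ?thesis .
qed

text \<open>Galois descent: an element of \<open>Gal F\<close> only permutes the summands, by
  composition from the left, whereas a value outside \<open>F\<close> would be moved by one of
  them.\<close>

lemma Psi_mem: assumes g: "g \<in> (E.Gal F \<rightarrow>\<^sub>E carrier G)" shows "base_character g \<in> F"
proof (rule ccontr)
  assume nF: "base_character g \<notin> F"
  obtain L \<phi> where L: "char_field G \<chi> \<subseteq> L" "field_hom_on L \<phi>" "\<And>k. k \<in> F \<Longrightarrow> \<phi> k = k" "\<phi> (base_character g) \<noteq> base_character g"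
    by (rule E.exists_moving_hom[OF F nF finite.emptyI]) blast
  define \<tau> where "\<tau> = (\<lambda>z. if z \<in> char_field G \<chi> then \<phi> z else z)"
  have \<tau>: "\<tau> \<in> E.Gal F" unfolding \<tau>_def by (rule E.restrict_Gal[OF L(2,1,3)])
  have "(\<Prod>t\<in>E.Gal F. inv_into UNIV t (\<chi> (g t))) \<in> char_field G \<chi>"
    using conjugate_value_mem[OF g] by (rule E.prod_mem)
  then have mem: "base_character g \<in> char_field G \<chi>"
    unfolding base_character_def by (blast intro: E.sum_mem E.Gal_mem)
  have "\<tau> (base_character g) = (\<Sum>a\<in>E.Gal F. \<Prod>t\<in>E.Gal F. (\<tau> \<circ> a) (inv_into UNIV t (\<chi> (g t))))"
    by (rule comp_base_character[OF \<tau> g])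
  also have "\<dots> = (\<Sum>a\<in>E.Gal F. \<Prod>t\<in>E.Gal F. a (inv_into UNIV t (\<chi> (g t))))"
  proof (rule sum.reindex_bij_witness[of _ "\<lambda>a. inv_into UNIV \<tau> \<circ> a" "\<lambda>a. \<tau> \<circ> a"])
    fix a assume "a \<in> E.Gal F"
    show "inv_into UNIV \<tau> \<circ> (\<tau> \<circ> a) = a"
      by (simp add: o_assoc E.Gal_inv_comp[OF \<tau>])
    show "\<tau> \<circ> (inv_into UNIV \<tau> \<circ> a) = a"
      by (simp add: o_assoc E.Gal_comp_inv[OF \<tau>])
    show "\<tau> \<circ> a \<in> E.Gal F" "inv_into UNIV \<tau> \<circ> a \<in> E.Gal F"
      using \<open>a \<in> E.Gal F\<close> \<tau> by (auto intro: E.comp_Gal E.inv_Gal)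
  qed simp
  also have "\<dots> = base_character g" using comp_base_character[OF E.id_Gal g] by simp
  finally show False using L(4) mem by (simp add: \<tau>_def)
qed

text \<open>The pairing of the tensor product character with its conjugate by \<open>\<beta>\<close>
  splits over the coordinates. In each of them, the conjugates of \<open>\<chi>\<close> by the
  inverse of \<open>t\<close> and by \<open>\<beta>\<close> after this inverse are orthogonal unless
  \<open>\<beta> = id\<close>.\<close>

lemma weighted_sum_base_character:
  assumes \<beta>: "\<beta> \<in> E.Gal {}"
  shows "(\<Sum>g\<in>(E.Gal F \<rightarrow>\<^sub>E carrier G). (\<Prod>t\<in>E.Gal F. inv_into UNIV t (\<chi> (inv (g t)))) * (\<Prod>t\<in>E.Gal F. \<beta> (inv_into UNIV t (\<chi> (g t))))) =
    (if \<beta> = id then of_nat (Coset.order G) ^ card (E.Gal F) else 0)"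
proof -
  have "(\<Sum>g\<in>(E.Gal F \<rightarrow>\<^sub>E carrier G). (\<Prod>t\<in>E.Gal F. inv_into UNIV t (\<chi> (inv (g t)))) * (\<Prod>t\<in>E.Gal F. \<beta> (inv_into UNIV t (\<chi> (g t))))) =
    (\<Prod>t\<in>E.Gal F. \<Sum>x\<in>carrier G. inv_into UNIV t (\<chi> (inv x)) * (\<beta> \<circ> inv_into UNIV t) (\<chi> x))"
    using fin by (simp add: prod_sum_PiE[OF E.finite_Gal] prod.distrib)
  also have "\<dots> = (\<Prod>t\<in>E.Gal F. if \<beta> = id then of_nat (Coset.order G) else 0)"
  proof (rule prod.cong[OF refl])
    fix t assume t: "t \<in> E.Gal F"
    have "inv_into UNIV t = \<beta> \<circ> inv_into UNIV t \<longleftrightarrow> \<beta> = id"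
    proof
      assume "inv_into UNIV t = \<beta> \<circ> inv_into UNIV t"
      then have "inv_into UNIV t \<circ> t = \<beta> \<circ> (inv_into UNIV t \<circ> t)" by (simp add: o_assoc)
      then show "\<beta> = id" using E.Gal_bij[OF t] by (simp add: bij_is_inj)
    qed simp
    moreover have it: "inv_into UNIV t \<in> E.Gal {}" by (rule inv_A[OF t])
    ultimately show "(\<Sum>x\<in>carrier G. inv_into UNIV t (\<chi> (inv x)) * (\<beta> \<circ> inv_into UNIV t) (\<chi> x)) =
        (if \<beta> = id then of_nat (Coset.order G) else 0)"
      using conjugate_character_orthogonality[OF it E.comp_Gal[OF \<beta> it]] by simp
  qed
  \<comment> \<open>\<open>Gal F\<close> contains \<open>id\<close>, so the product is not empty and
    does vanish for \<open>\<beta> \<noteq> id\<close>.\<close>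
  also have "\<dots> = (if \<beta> = id then of_nat (Coset.order G) ^ card (E.Gal F) else 0)"
    using E.finite_Gal E.id_Gal[of F] by (auto simp: card_gt_0_iff)
  finally show ?thesis .
qed

text \<open>Suppose \<open>\<tau>\<close> fixes every value of \<open>base_character\<close>.
  Pairing with the tensor product character then gives the same result for \<open>\<tau>\<close> as
  for \<open>id\<close>, which is nonzero; so \<open>\<tau> \<circ> a = id\<close> for some
  \<open>a\<close> in \<open>Gal F\<close>, and \<open>\<tau>\<close> fixes \<open>F\<close>.
  Inserting 0 accounts for the zero values of the induced character off the base group.\<close>

lemma gen_field_base_character: "gen_field (insert 0 (base_character ` (E.Gal F \<rightarrow>\<^sub>E carrier G))) = F"
proof
  let ?K = "gen_field (insert 0 (base_character ` (E.Gal F \<rightarrow>\<^sub>E carrier G)))"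
  show KF: "?K \<subseteq> F" using Psi_mem F by (intro gen_field_least) (auto simp: is_subfield_def)
  show "F \<subseteq> ?K"
  proof (rule subsetI, rule ccontr)
    fix x assume x: "x \<in> F" "x \<notin> ?K"
    obtain L \<phi> where L: "char_field G \<chi> \<subseteq> L" "field_hom_on L \<phi>" "\<And>k. k \<in> ?K \<Longrightarrow> \<phi> k = k" "\<phi> x \<noteq> x"
      by (rule E.exists_moving_hom[OF is_subfield_gen_field order_trans[OF KF F(2)] x(2) finite.emptyI]) blast
    define \<tau> where "\<tau> = (\<lambda>z. if z \<in> char_field G \<chi> then \<phi> z else z)"
    have \<tau>: "\<tau> \<in> E.Gal ?K" unfolding \<tau>_def by (rule E.restrict_Gal[OF L(2,1,3)])
    then have \<tau>0: "\<tau> \<in> E.Gal {}" using E.Gal_antimono[of "{}" ?K] by blast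
    \<comment> \<open>\<open>w\<close> is the tensor product character at the inverse of
      \<open>g\<close>; summing against it is the inner product up to the order of the base
      group.\<close>
    define w where "w g = (\<Prod>t\<in>E.Gal F. inv_into UNIV t (\<chi> (inv (g t))))" for g
    have sum_w: "(\<Sum>g\<in>(E.Gal F \<rightarrow>\<^sub>E carrier G). w g * \<beta> (base_character g)) = (\<Sum>a\<in>E.Gal F. if \<beta> \<circ> a = id then of_nat (Coset.order G) ^ card (E.Gal F) else 0)"
      if "\<beta> \<in> E.Gal {}" for \<beta>
    proof -
      have "(\<Sum>g\<in>(E.Gal F \<rightarrow>\<^sub>E carrier G). w g * \<beta> (base_character g)) =
        (\<Sum>g\<in>(E.Gal F \<rightarrow>\<^sub>E carrier G). \<Sum>a\<in>E.Gal F. w g * (\<Prod>t\<in>E.Gal F. (\<beta> \<circ> a) (inv_into UNIV t (\<chi> (g t)))))"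
        by (intro sum.cong refl) (simp add: comp_base_character[OF that] sum_distrib_left)
      also have "\<dots> = (\<Sum>a\<in>E.Gal F. if \<beta> \<circ> a = id then of_nat (Coset.order G) ^ card (E.Gal F) else 0)"
      proof (subst sum.swap, rule sum.cong[OF refl])
        fix a assume "a \<in> E.Gal F"
        then have "\<beta> \<circ> a \<in> E.Gal {}" using that A_sub by (blast intro: E.comp_Gal)
        from weighted_sum_base_character[OF this]
        show "(\<Sum>g\<in>(E.Gal F \<rightarrow>\<^sub>E carrier G). w g * (\<Prod>t\<in>E.Gal F. (\<beta> \<circ> a) (inv_into UNIV t (\<chi> (g t))))) =
          (if \<beta> \<circ> a = id then of_nat (Coset.order G) ^ card (E.Gal F) else 0)"
          unfolding w_def .
      qed
      finally show ?thesis .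
    qed
    have "\<tau> (base_character g) = base_character g" if "g \<in> (E.Gal F \<rightarrow>\<^sub>E carrier G)" for g
      by (rule E.Gal_fix[OF \<tau> subsetD[OF gen_field_superset]]) (use that in simp)
    then have "(\<Sum>g\<in>(E.Gal F \<rightarrow>\<^sub>E carrier G). w g * \<tau> (base_character g)) = (\<Sum>g\<in>(E.Gal F \<rightarrow>\<^sub>E carrier G). w g * id (base_character g))"
      by (intro sum.cong refl) simp
    then have "(\<Sum>a\<in>E.Gal F. if \<tau> \<circ> a = id then of_nat (Coset.order G) ^ card (E.Gal F) else (0 :: complex)) =
      (\<Sum>a\<in>E.Gal F. if a = id then of_nat (Coset.order G) ^ card (E.Gal F) else 0)"
      unfolding sum_w[OF \<tau>0] sum_w[OF E.id_Gal] by simp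
    also have "\<dots> = of_nat (Coset.order G) ^ card (E.Gal F)"
      using E.finite_Gal E.id_Gal[of F] by simp
    finally have ne: "(\<Sum>a\<in>E.Gal F. if \<tau> \<circ> a = id then of_nat (Coset.order G) ^ card (E.Gal F) else (0 :: complex)) \<noteq> 0"
      using fin order_gt_0_iff_finite by simp
    have "\<exists>a\<in>E.Gal F. \<tau> \<circ> a = id"
    proof (rule ccontr)
      assume "\<not> ?thesis"
      then have "(\<Sum>a\<in>E.Gal F. if \<tau> \<circ> a = id then of_nat (Coset.order G) ^ card (E.Gal F) else (0 :: complex)) = 0"
        by (intro sum.neutral) simp
      with ne show False ..
    qed
    then obtain a where a: "a \<in> E.Gal F" "\<tau> \<circ> a = id" by blast
    then have "\<tau> (a x) = x" by (metis comp_apply id_apply)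
    then have "\<tau> x = x" using E.Gal_fix[OF a(1) x(1)] by simp
    moreover have "x \<in> char_field G \<chi>" using x(1) F(2) by blast
    ultimately show False using L(4) by (simp add: \<tau>_def)
  qed
qed

lemma wreath_character:
  "\<exists>\<psi>. irr_char (wreath G (E.Gal_group F)) \<psi> \<and> char_field (wreath G (E.Gal_group F)) \<psi> = F \<and>
     \<psi> \<one>\<^bsub>wreath G (E.Gal_group F)\<^esub> = of_nat (card (E.Gal F)) * of_nat d ^ card (E.Gal F)"
proof -
  let ?A = "E.Gal_group F" and ?W = "wreath G (E.Gal_group F)"
  have Gal_group_simps: "carrier ?A = E.Gal F" "\<one>\<^bsub>?A\<^esub> = id" "\<And>s t. s \<otimes>\<^bsub>?A\<^esub> t = s \<circ> t" by (simp_all add: E.Gal_group_def)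
  have finA: "finite (carrier ?A)" unfolding Gal_group_simps by (rule E.finite_Gal)
  obtain \<rho>s where irrs: "\<And>\<sigma>. \<sigma> \<in> E.Gal {} \<Longrightarrow> irreducible_rep G d (\<rho>s \<sigma>)"
    and tr: "\<And>\<sigma> g. \<sigma> \<in> E.Gal {} \<Longrightarrow> g \<in> carrier G \<Longrightarrow> mat_trace (\<rho>s \<sigma> g) = \<sigma> (\<chi> g)"
    and orth: "\<And>\<sigma> \<tau> i j k l. \<sigma> \<in> E.Gal {} \<Longrightarrow> \<tau> \<in> E.Gal {} \<Longrightarrow> i < d \<Longrightarrow> j < d \<Longrightarrow> k < d \<Longrightarrow> l < d \<Longrightarrow>
      (\<Sum>g\<in>carrier G. \<rho>s \<sigma> (inv g) $$ (i, j) * \<rho>s \<tau> g $$ (k, l)) =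
      (if \<sigma> = \<tau> \<and> i = l \<and> j = k then of_nat (Coset.order G) / of_nat d else 0)"
    by (rule conjugate_reps) blast
  have carr: "\<rho>s \<sigma> g \<in> carrier_mat d d" if "\<sigma> \<in> E.Gal {}" "g \<in> carrier G" for \<sigma> g
    using irrs that unfolding irreducible_rep_def is_rep_def by blast
  define r :: "(complex \<Rightarrow> complex) \<Rightarrow> 'g \<Rightarrow> nat \<Rightarrow> nat \<Rightarrow> complex"
    where "r y g i j = \<rho>s (inv_into UNIV y) g $$ (i, j)" for y g i j
  have char: "(\<Sum>i<d. r y g i i) = inv_into UNIV y (\<chi> g)" if "y \<in> E.Gal F" "g \<in> carrier G" for y g
    unfolding r_def using tr[OF inv_A[OF that(1)] that(2)] mat_trace_eq[OF carr[OF inv_A[OF that(1)] that(2)]] by simp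
  define \<psi> where "\<psi> = (\<lambda>(g, s :: complex \<Rightarrow> complex). if s = id then \<Sum>a\<in>E.Gal F. \<Prod>y\<in>E.Gal F. \<Sum>i<d. r y (g (y \<circ> a)) i i else 0)"
  have "irr_char ?W (\<lambda>(g, s). if s = \<one>\<^bsub>?A\<^esub> then
     \<Sum>a\<in>carrier ?A. \<Prod>y\<in>carrier ?A. \<Sum>i<d. r y (g (y \<otimes>\<^bsub>?A\<^esub> a)) i i else 0)"
  proof (rule irr_char_wreath[OF grp fin E.Gal_group finA dim_pos, where r = r])
    show "of_nat (Coset.order G) / of_nat d \<noteq> (0 :: complex)"
      using fin dim_pos order_gt_0_iff_finite by simp
  next
    fix y and i j :: nat assume y: "y \<in> carrier ?A" and ij: "i < d" "j < d"
    have "\<rho>s (inv_into UNIV y) \<one> = 1\<^sub>m d"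
      using irrs[OF inv_A] y unfolding Gal_group_simps irreducible_rep_def is_rep_def by blast
    then show "r y \<one> i j = (if i = j then 1 else 0)" using ij by (simp add: r_def)
  next
    fix y g h and i j :: nat assume y: "y \<in> carrier ?A" and gh: "g \<in> carrier G" "h \<in> carrier G" and ij: "i < d" "j < d"
    have iy: "inv_into UNIV y \<in> E.Gal {}" using y unfolding Gal_group_simps by (rule inv_A)
    have "\<rho>s (inv_into UNIV y) (g \<otimes> h) = \<rho>s (inv_into UNIV y) g * \<rho>s (inv_into UNIV y) h"
      using irrs[OF iy] gh unfolding irreducible_rep_def is_rep_def by blast
    then show "r y (g \<otimes> h) i j = (\<Sum>k<d. r y g i k * r y h k j)"
      unfolding r_def using mult_mat_index[OF carr[OF iy gh(1)] carr[OF iy gh(2)] ij] by simp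
  next
    fix x y and i j k l :: nat
    assume xy: "x \<in> carrier ?A" "y \<in> carrier ?A" and ijkl: "i < d" "j < d" "k < d" "l < d"
    have "inv_into UNIV x = inv_into UNIV y \<longleftrightarrow> x = y"
      using xy unfolding Gal_group_simps by (metis E.Gal_bij inv_inv_eq)
    then show "(\<Sum>g\<in>carrier G. r x (inv g) i j * r y g k l) =
      (if x = y \<and> i = l \<and> j = k then of_nat (Coset.order G) / of_nat d else 0)"
      unfolding r_def using orth[OF inv_A inv_A ijkl, of x y] xy unfolding Gal_group_simps by simp
  qed
  then have irr_W: "irr_char ?W \<psi>" unfolding Gal_group_simps \<psi>_def .
  have val: "\<psi> (g, id) = base_character g" if g: "g \<in> (E.Gal F \<rightarrow>\<^sub>E carrier G)" for g
  proof -
    have "\<psi> (g, id) = (\<Sum>a\<in>E.Gal F. \<Prod>y\<in>E.Gal F. inv_into UNIV y (\<chi> (g (y \<circ> a))))"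
      unfolding \<psi>_def using g by (auto intro!: sum.cong prod.cong char intro: E.comp_Gal dest: PiE_mem)
    \<comment> \<open>The substitution \<open>t = y \<circ> a\<close> turns the inverse of
      \<open>y\<close> into \<open>a\<close> after the inverse of \<open>t\<close>. This is why the
      factor at \<open>y\<close> is conjugated by the inverse of \<open>y\<close>: summand
      \<open>a\<close> becomes the image under \<open>a\<close> of the summand for
      \<open>id\<close>.\<close>
    also have "\<dots> = (\<Sum>a\<in>E.Gal F. \<Prod>t\<in>E.Gal F. a (inv_into UNIV t (\<chi> (g t))))"
    proof (rule sum.cong[OF refl])
      fix a assume a: "a \<in> E.Gal F"
      note bij_a = E.Gal_bij[OF a]
      show "(\<Prod>y\<in>E.Gal F. inv_into UNIV y (\<chi> (g (y \<circ> a)))) = (\<Prod>t\<in>E.Gal F. a (inv_into UNIV t (\<chi> (g t))))"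
      proof (rule prod.reindex_bij_witness[of _ "\<lambda>t. t \<circ> inv_into UNIV a" "\<lambda>y. y \<circ> a"])
        fix y assume y: "y \<in> E.Gal F"
        show "y \<circ> a \<circ> inv_into UNIV a = y" "y \<circ> inv_into UNIV a \<circ> a = y"
          by (simp_all add: o_assoc[symmetric] E.Gal_comp_inv[OF a] E.Gal_inv_comp[OF a])
        show "y \<circ> a \<in> E.Gal F" "y \<circ> inv_into UNIV a \<in> E.Gal F" using a y by (auto intro: E.comp_Gal E.inv_Gal)
        have "inv_into UNIV (y \<circ> a) = inv_into UNIV a \<circ> inv_into UNIV y"
          using bij_a E.Gal_bij[OF y] by (rule o_inv_distrib[rotated])
        then show "a (inv_into UNIV (y \<circ> a) (\<chi> (g (y \<circ> a)))) = inv_into UNIV y (\<chi> (g (y \<circ> a)))"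
          using bij_a by (simp add: bij_is_surj surj_f_inv_f)
      qed
    qed
    also have "\<dots> = base_character g" using comp_base_character[OF E.id_Gal g] by simp
    finally show ?thesis .
  qed
  have W: "carrier ?W = (E.Gal F \<rightarrow>\<^sub>E carrier G) \<times> E.Gal F" by (simp add: wreath_def Gal_group_simps)
  have "insert 0 (\<psi> ` carrier ?W) = insert 0 (base_character ` (E.Gal F \<rightarrow>\<^sub>E carrier G))"
  proof
    have "\<psi> (g, s) \<in> insert 0 (base_character ` (E.Gal F \<rightarrow>\<^sub>E carrier G))" if "g \<in> (E.Gal F \<rightarrow>\<^sub>E carrier G)" for g s
      using that val[OF that] by (cases "s = id") (auto simp: \<psi>_def)
    then show "insert 0 (\<psi> ` carrier ?W) \<subseteq> insert 0 (base_character ` (E.Gal F \<rightarrow>\<^sub>E carrier G))" unfolding W by blast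
    have "base_character g \<in> \<psi> ` carrier ?W" if "g \<in> (E.Gal F \<rightarrow>\<^sub>E carrier G)" for g
      using that E.id_Gal[of F] by (intro image_eqI[of _ _ "(g, id)"]) (auto simp: W val)
    then show "insert 0 (base_character ` (E.Gal F \<rightarrow>\<^sub>E carrier G)) \<subseteq> insert 0 (\<psi> ` carrier ?W)" by blast
  qed
  moreover have "char_field ?W \<psi> = gen_field (insert 0 (\<psi> ` carrier ?W))"
  proof
    show "char_field ?W \<psi> \<subseteq> gen_field (insert 0 (\<psi> ` carrier ?W))"
      unfolding char_field_def
      by (rule gen_field_least[OF is_subfield_gen_field order_trans[OF subset_insertI gen_field_superset]])
    have "0 \<in> char_field ?W \<psi>"
      using is_subfield_gen_field unfolding char_field_def is_subfield_def by blast
    then show "gen_field (insert 0 (\<psi> ` carrier ?W)) \<subseteq> char_field ?W \<psi>"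
      using gen_field_superset[of "\<psi> ` carrier ?W"] unfolding char_field_def
      by (intro gen_field_least is_subfield_gen_field) auto
  qed
  ultimately have "char_field ?W \<psi> = F" using gen_field_base_character by simp
  moreover have "\<psi> \<one>\<^bsub>?W\<^esub> = of_nat (card (E.Gal F)) * of_nat d ^ card (E.Gal F)"
  proof -
    have "\<sigma> (\<chi> \<one>) = of_nat d" if "\<sigma> \<in> E.Gal {}" for \<sigma>
    proof -
      interpret subfield_hom "char_field G \<chi>" \<sigma> using that by (rule E.Gal_field_hom)
      have "\<chi> \<one> = of_nat d" using is_rep_rho by (simp add: trace is_rep_def mat_trace_def)
      then show ?thesis by simp
    qed
    then have "(\<Sum>i<d. r y \<one> i i) = of_nat d" if "y \<in> E.Gal F" for y
      using char[OF that] inv_A[OF that] by simp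
    then have "(\<Sum>i<d. r y ((\<lambda>t\<in>E.Gal F. \<one>) (y \<circ> a)) i i) = of_nat d" if "y \<in> E.Gal F" "a \<in> E.Gal F" for y a
      using E.comp_Gal[OF that] that by simp
    then have "(\<Sum>a\<in>E.Gal F. \<Prod>y\<in>E.Gal F. \<Sum>i<d. r y ((\<lambda>t\<in>E.Gal F. \<one>) (y \<circ> a)) i i) = (\<Sum>a\<in>E.Gal F. \<Prod>y\<in>E.Gal F. of_nat d)"
      by (intro sum.cong prod.cong refl)
    then show ?thesis by (simp add: wreath_def Gal_group_simps \<psi>_def)
  qed
  ultimately show ?thesis using irr_W by blast
qed

end

end

theorem theorem2p5:
  fixes G :: "('g, 'b) monoid_scheme" and \<chi> :: "'g \<Rightarrow> complex" and F :: "complex set"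
  assumes "group G" and "finite (carrier G)" and "irr_char G \<chi>"
    and "is_subfield F" and "F \<subseteq> char_field G \<chi>"
  shows "\<exists>(H :: nat monoid) (\<psi> :: nat \<Rightarrow> complex).
           group H \<and> finite (carrier H) \<and> irr_char H \<psi> \<and> char_field H \<psi> = F \<and>
           \<psi> (\<one>\<^bsub>H\<^esub>) = of_nat (field_degree (char_field G \<chi>) F)
                          * \<chi> (\<one>\<^bsub>G\<^esub>) ^ field_degree (char_field G \<chi>) F"
proof -
  obtain d \<rho> where irr: "irreducible_rep G d \<rho>" and trace: "\<And>g. g \<in> carrier G \<Longrightarrow> \<chi> g = mat_trace (\<rho> g)"
    using assms(3) unfolding irr_char_def by blast
  interpret group G by (rule assms(1))
  interpret E: normal_field "\<chi> ` carrier G" "char_field G \<chi>"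
    using normal_field_char_field[OF assms(1,2) irr trace] .
  let ?W = "wreath G (E.Gal_group F)"
  obtain \<psi> where \<psi>: "irr_char ?W \<psi>" "char_field ?W \<psi> = F"
    "\<psi> \<one>\<^bsub>?W\<^esub> = of_nat (card (E.Gal F)) * of_nat d ^ card (E.Gal F)"
    using wreath_character[OF assms(1,2) irr trace assms(4,5)] by blast
  have fin_Gal: "finite (carrier (E.Gal_group F))"
    using E.finite_Gal by (simp add: E.Gal_group_def)
  have grp_W: "group ?W" "finite (carrier ?W)"
    using group_wreath[OF assms(1,2) E.Gal_group fin_Gal] finite_wreath[OF assms(1,2) E.Gal_group fin_Gal] .
  have "\<rho> \<one>\<^bsub>G\<^esub> = 1\<^sub>m d" using irr unfolding irreducible_rep_def is_rep_def by blast
  then have "\<chi> \<one>\<^bsub>G\<^esub> = of_nat d" using trace by (simp add: mat_trace_def)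
  then have "\<psi> \<one>\<^bsub>?W\<^esub> = of_nat (field_degree (char_field G \<chi>) F) * \<chi> \<one>\<^bsub>G\<^esub> ^ field_degree (char_field G \<chi>) F"
    using \<psi>(3) E.field_degree_eq_card_Gal[OF assms(4,5)] by simp
  then show ?thesis
    using nat_group_with_same_character[OF grp_W \<psi>(1)] \<psi>(2) by metis
qed

end
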